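(* For any integer $n\geq 2$, there are pointwise finite-dimensional (pfd) $2$-parameter modules $M$, $Q$, $N_1$, $N_2$ such that $M\oplus Q$ and $N_1\oplus N_2$ are $1$-interleaved, $\sup_{p}\dim M_p = 2n$ and $\sup_p\dim Q_p \leq 2n-1$, and such that for any $0\le\delta< n-1$ and any $R \in \mathrm{EN}_\delta(M)$, there is an $R'\in B(R)$ such that $R'$ is not a subquotient of $N_1$ and $R'$ is not a subquotient of $N_2$.
   Context: Fix a field $k$. A $2$-parameter module is a functor $M\colon\mathbb{R}^2\to\mathbf{Vec}_k$, where $\mathbb{R}^2$ has the product partial order, with vector spaces $M_p$ and maps $M_{p\to q}$ for $p\le q$; morphisms are natural transformations. $M$ is pfd if every $M_p$ is finite-dimensional. For $\epsilon\in\mathbb{R}$, $M(\epsilon)$ is the module with $M(\epsilon)_p=M_{p+(\epsilon,\epsilon)}$ and the corresponding maps, and $f(\epsilon)_p=f_{p+(\epsilon,\epsilon)}$ for morphisms $f$. For $\epsilon\le\delta$, $M_{\epsilon\to\delta}\colon M(\epsilon)\to M(\delta)$ is the morphism given by $(M_{\epsilon\to\delta})_p=M_{p+(\epsilon,\epsilon)\to p+(\delta,\delta)}$. $M$ and $N$ are $\epsilon$-interleaved if there are morphisms $\phi\colon M\to N(\epsilon)$, $\psi\colon N\to M(\epsilon)$ with $\psi(\epsilon)\circ\phi=M_{0\to2\epsilon}$ and $\phi(\epsilon)\circ\psi=N_{0\to2\epsilon}$. Every pfd module is a direct sum $\bigoplus_{i\in\Lambda}M_i$ of nonzero indecomposable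 modules, essentially uniquely; $B(M)$ is the multiset $\{M_i\}_{i\in\Lambda}$ of isomorphism classes. $N$ is a subquotient of $M$ if there are a module $M'$, a monomorphism $M'\hookrightarrow M$ and an epimorphism $M'\twoheadrightarrow N$. For $\delta\ge0$ let $\mathrm{Im}_\delta(M)=\operatorname{im}(M_{-\delta\to0})\subseteq M$ and $\mathrm{Ker}_\delta(M)=\ker(M_{0\to\delta})\subseteq M$. $\mathrm{EN}_\delta(M)$ is the collection of modules isomorphic to some $M_1/M_2$ with $M_2\subseteq M_1\subseteq M$ submodules, $\mathrm{Im}_\delta(M)\subseteq M_1$ and $M_2\subseteq\mathrm{Ker}_\delta(M)$. *)

theory Defs
  imports
    "Jordan_Normal_Form.Missing_VectorSpace"
    "HOL-Algebra.AbelCoset"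
    "HOL-Library.Product_Order"
    "HOL-Library.Extended_Nat"
    Complex_Main
begin

text \<open>
  A record of this type holds the data of a functor from the poset of pairs of reals (ordered
  componentwise, \<^theory>\<open>HOL-Library.Product_Order\<close>) to vector spaces with elements in \<^typ>\<open>'v\<close>:
  \<open>pm_map M p q\<close> is the map from \<open>pm_space M p\<close> to \<open>pm_space M q\<close>. It is meaningful only for \<open>p \<le> q\<close>
  and on the carrier of \<open>pm_space M p\<close>.
\<close>

record ('k, 'v) pmod =
  pm_space :: "real \<times> real \<Rightarrow> ('k, 'v) module"
  pm_map :: "real \<times> real \<Rightarrow> real \<times> real \<Rightarrow> 'v \<Rightarrow> 'v"

locale persistence_module =
  fixes K :: "('k, 'm) ring_scheme" and M :: "('k, 'v) pmod"
  assumes vectorspace_pm_space: "vectorspace K (pm_space M p)"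
    and map_hom: "p \<le> q \<Longrightarrow> pm_map M p q \<in> LinearCombinations.module_hom K (pm_space M p) (pm_space M q)"
    and map_id: "x \<in> carrier (pm_space M p) \<Longrightarrow> pm_map M p p x = x"
    and map_comp: "\<lbrakk>p \<le> q; q \<le> r; x \<in> carrier (pm_space M p)\<rbrakk>
          \<Longrightarrow> pm_map M q r (pm_map M p q x) = pm_map M p r x"

definition pfd :: "('k, 'm) ring_scheme \<Rightarrow> ('k, 'v) pmod \<Rightarrow> bool" where
  "pfd K M \<longleftrightarrow> persistence_module K M \<and> (\<forall>p. vectorspace.fin_dim K (pm_space M p))"

definition pm_hom ::
  "('k, 'm) ring_scheme \<Rightarrow> ('k, 'v) pmod \<Rightarrow> ('k, 'w) pmod \<Rightarrow> (real \<times> real \<Rightarrow> 'v \<Rightarrow> 'w) set" where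
  "pm_hom K M N = {f.
     (\<forall>p. f p \<in> LinearCombinations.module_hom K (pm_space M p) (pm_space N p)) \<and>
     (\<forall>p q. p \<le> q \<longrightarrow> (\<forall>x\<in>carrier (pm_space M p). f q (pm_map M p q x) = pm_map N p q (f p x)))}"

definition pm_mono ::
  "('k, 'm) ring_scheme \<Rightarrow> ('k, 'v) pmod \<Rightarrow> ('k, 'w) pmod \<Rightarrow> (real \<times> real \<Rightarrow> 'v \<Rightarrow> 'w) set" where
  "pm_mono K M N = {f \<in> pm_hom K M N. \<forall>p. inj_on (f p) (carrier (pm_space M p))}"

definition pm_epi ::
  "('k, 'm) ring_scheme \<Rightarrow> ('k, 'v) pmod \<Rightarrow> ('k, 'w) pmod \<Rightarrow> (real \<times> real \<Rightarrow> 'v \<Rightarrow> 'w) set" where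
  "pm_epi K M N = {f \<in> pm_hom K M N. \<forall>p. f p ` carrier (pm_space M p) = carrier (pm_space N p)}"

definition pm_iso :: "('k, 'm) ring_scheme \<Rightarrow> ('k, 'v) pmod \<Rightarrow> ('k, 'w) pmod \<Rightarrow> bool" where
  "pm_iso K M N \<longleftrightarrow> (\<exists>f\<in>pm_hom K M N. \<exists>g\<in>pm_hom K N M. \<forall>p.
     (\<forall>x\<in>carrier (pm_space M p). g p (f p x) = x) \<and> (\<forall>y\<in>carrier (pm_space N p). f p (g p y) = y))"

subsection \<open>Shifts and interleavings\<close>

definition pm_shift :: "real \<Rightarrow> ('k, 'v) pmod \<Rightarrow> ('k, 'v) pmod" where
  "pm_shift \<epsilon> M = \<lparr>pm_space = (\<lambda>p. pm_space M (p + (\<epsilon>, \<epsilon>))),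
                  pm_map = (\<lambda>p q. pm_map M (p + (\<epsilon>, \<epsilon>)) (q + (\<epsilon>, \<epsilon>)))\<rparr>"

definition hom_shift :: "real \<Rightarrow> (real \<times> real \<Rightarrow> 'v \<Rightarrow> 'w) \<Rightarrow> real \<times> real \<Rightarrow> 'v \<Rightarrow> 'w" where
  "hom_shift \<epsilon> f = (\<lambda>p. f (p + (\<epsilon>, \<epsilon>)))"

definition shift_trans :: "('k, 'v) pmod \<Rightarrow> real \<Rightarrow> real \<Rightarrow> real \<times> real \<Rightarrow> 'v \<Rightarrow> 'v" where
  "shift_trans M \<epsilon> \<delta> = (\<lambda>p. pm_map M (p + (\<epsilon>, \<epsilon>)) (p + (\<delta>, \<delta>)))"

definition interleaved ::
  "('k, 'm) ring_scheme \<Rightarrow> real \<Rightarrow> ('k, 'v) pmod \<Rightarrow> ('k, 'w) pmod \<Rightarrow> bool" where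
  "interleaved K \<epsilon> M N \<longleftrightarrow>
     (\<exists>\<phi>\<in>pm_hom K M (pm_shift \<epsilon> N). \<exists>\<psi>\<in>pm_hom K N (pm_shift \<epsilon> M). \<forall>p.
        (\<forall>x\<in>carrier (pm_space M p). hom_shift \<epsilon> \<psi> p (\<phi> p x) = shift_trans M 0 (2 * \<epsilon>) p x) \<and>
        (\<forall>y\<in>carrier (pm_space N p). hom_shift \<epsilon> \<phi> p (\<psi> p y) = shift_trans N 0 (2 * \<epsilon>) p y))"

subsection \<open>Direct sums and indecomposables\<close>

definition pm_sum :: "('k, 'v) pmod \<Rightarrow> ('k, 'w) pmod \<Rightarrow> ('k, 'v \<times> 'w) pmod" where
  "pm_sum M N = \<lparr>pm_space = (\<lambda>p. direct_sum (pm_space M p) (pm_space N p)),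
                 pm_map = (\<lambda>p q. map_prod (pm_map M p q) (pm_map N p q))\<rparr>"

text \<open>As in \<^const>\<open>direct_sum\<close>, the ring multiplication and unit required by the record type are
  irrelevant and set to zero.\<close>

definition family_sum :: "'i set \<Rightarrow> ('i \<Rightarrow> ('k, 'v) module) \<Rightarrow> ('k, 'i \<Rightarrow> 'v) module" where
  "family_sum I V =
     \<lparr>carrier = {x \<in> (\<Pi>\<^sub>E i\<in>I. carrier (V i)). finite {i \<in> I. x i \<noteq> \<zero>\<^bsub>V i\<^esub>}},
      mult = (\<lambda>x y. \<lambda>i\<in>I. \<zero>\<^bsub>V i\<^esub>),
      one = (\<lambda>i\<in>I. \<zero>\<^bsub>V i\<^esub>),
      zero = (\<lambda>i\<in>I. \<zero>\<^bsub>V i\<^esub>),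
      add = (\<lambda>x y. \<lambda>i\<in>I. x i \<oplus>\<^bsub>V i\<^esub> y i),
      smult = (\<lambda>c x. \<lambda>i\<in>I. c \<odot>\<^bsub>V i\<^esub> x i)\<rparr>"

definition pm_family_sum :: "'i set \<Rightarrow> ('i \<Rightarrow> ('k, 'v) pmod) \<Rightarrow> ('k, 'i \<Rightarrow> 'v) pmod" where
  "pm_family_sum I F = \<lparr>pm_space = (\<lambda>p. family_sum I (\<lambda>i. pm_space (F i) p)),
                        pm_map = (\<lambda>p q x. \<lambda>i\<in>I. pm_map (F i) p q (x i))\<rparr>"

definition zero_pmod :: "('k, 'v) pmod \<Rightarrow> bool" where
  "zero_pmod M \<longleftrightarrow> (\<forall>p. carrier (pm_space M p) = {\<zero>\<^bsub>pm_space M p\<^esub>})"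

text \<open>Summands of \<open>M\<close> are isomorphic to submodules of \<open>M\<close>, so it is no restriction to take them over
  the same type of elements \<^typ>\<open>'v\<close>.\<close>

definition indecomposable :: "('k, 'm) ring_scheme \<Rightarrow> ('k, 'v) pmod \<Rightarrow> bool" where
  "indecomposable K M \<longleftrightarrow> persistence_module K M \<and> \<not> zero_pmod M \<and>
     (\<forall>(A :: ('k, 'v) pmod) (B :: ('k, 'v) pmod).
        persistence_module K A \<and> persistence_module K B \<and> pm_iso K M (pm_sum A B)
          \<longrightarrow> zero_pmod A \<or> zero_pmod B)"

text \<open>
  The family \<open>F\<close> over \<open>I\<close> represents the multiset \<open>B(M)\<close>. The index type is large enough for every
  pfd module \<open>M\<close>: label each summand by a point where it is nonzero, together with a natural number
  separating the finitely many summands that are nonzero at that point.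
\<close>

definition barcode_family ::
  "('k, 'm) ring_scheme \<Rightarrow> ('k, 'v) pmod \<Rightarrow> ((real \<times> real) \<times> nat) set
     \<Rightarrow> ((real \<times> real) \<times> nat \<Rightarrow> ('k, 'v) pmod) \<Rightarrow> bool" where
  "barcode_family K M I F \<longleftrightarrow> (\<forall>i\<in>I. indecomposable K (F i)) \<and> pm_iso K M (pm_family_sum I F)"

text \<open>The modules whose isomorphism class is an element of \<open>B(M)\<close>. Multiplicities play no role for
  membership, and the choice of decomposition is immaterial by essential uniqueness.\<close>

definition barcode :: "('k, 'm) ring_scheme \<Rightarrow> ('k, 'v) pmod \<Rightarrow> ('k, 'v) pmod set" where
  "barcode K M = {N. persistence_module K N \<and>
     (\<exists>I F. barcode_family K M I F \<and> (\<exists>i\<in>I. pm_iso K N (F i)))}"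

subsection \<open>Submodules, quotients and erosion neighborhoods\<close>

text \<open>\<open>M'\<close> is isomorphic to a submodule of \<open>M\<close>, so it may be taken over the same type.\<close>

definition subquotient :: "('k, 'm) ring_scheme \<Rightarrow> ('k, 'w) pmod \<Rightarrow> ('k, 'v) pmod \<Rightarrow> bool" where
  "subquotient K N M \<longleftrightarrow> (\<exists>M' :: ('k, 'v) pmod. persistence_module K M' \<and>
     pm_mono K M' M \<noteq> {} \<and> pm_epi K M' N \<noteq> {})"

text \<open>Submodules are given by their families of underlying subspaces.\<close>

definition pm_submodule ::
  "('k, 'm) ring_scheme \<Rightarrow> (real \<times> real \<Rightarrow> 'v set) \<Rightarrow> ('k, 'v) pmod \<Rightarrow> bool" where
  "pm_submodule K S M \<longleftrightarrow> (\<forall>p. VectorSpace.subspace K (S p) (pm_space M p)) \<and>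
     (\<forall>p q. p \<le> q \<longrightarrow> pm_map M p q ` S p \<subseteq> S q)"

definition pm_restrict :: "('k, 'v) pmod \<Rightarrow> (real \<times> real \<Rightarrow> 'v set) \<Rightarrow> ('k, 'v) pmod" where
  "pm_restrict M S = \<lparr>pm_space = (\<lambda>p. (pm_space M p)\<lparr>carrier := S p\<rparr>), pm_map = pm_map M\<rparr>"

text \<open>The elements of the quotient of \<open>V\<close> by \<open>W\<close> are the cosets of \<open>W\<close>. Adding \<open>W\<close> to the image of a
  coset under a linear map that respects the subspaces gives the whole coset it lands in; in
  particular \<open>0\<close> times a coset is \<open>W\<close>.\<close>

definition quotient_space :: "('k, 'v) module \<Rightarrow> 'v set \<Rightarrow> ('k, 'v set) module" where
  "quotient_space V W =
     \<lparr>carrier = a_rcosets\<^bsub>V\<^esub> W,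
      mult = (\<lambda>X Y. W),
      one = W,
      zero = W,
      add = (\<lambda>X Y. X <+>\<^bsub>V\<^esub> Y),
      smult = (\<lambda>c X. W <+>\<^bsub>V\<^esub> ((\<lambda>x. c \<odot>\<^bsub>V\<^esub> x) ` X))\<rparr>"

definition pm_quotient :: "('k, 'v) pmod \<Rightarrow> (real \<times> real \<Rightarrow> 'v set) \<Rightarrow> ('k, 'v set) pmod" where
  "pm_quotient M S = \<lparr>pm_space = (\<lambda>p. quotient_space (pm_space M p) (S p)),
                      pm_map = (\<lambda>p q X. S q <+>\<^bsub>pm_space M q\<^esub> (pm_map M p q ` X))\<rparr>"

definition pm_Im :: "real \<Rightarrow> ('k, 'v) pmod \<Rightarrow> real \<times> real \<Rightarrow> 'v set" where
  "pm_Im \<delta> M = (\<lambda>p. shift_trans M (- \<delta>) 0 p ` carrier (pm_space (pm_shift (- \<delta>) M) p))"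

definition pm_Ker :: "real \<Rightarrow> ('k, 'v) pmod \<Rightarrow> real \<times> real \<Rightarrow> 'v set" where
  "pm_Ker \<delta> M = (\<lambda>p. {x \<in> carrier (pm_space M p).
     shift_trans M 0 \<delta> p x = \<zero>\<^bsub>pm_space (pm_shift \<delta> M) p\<^esub>})"

text \<open>For pfd \<open>M\<close>, every quotient \<open>M\<^sub>1 / M\<^sub>2\<close> has an isomorphic copy over the type of elements of
  \<open>M\<close> (spanned by complements), so it suffices to collect the modules over that type.\<close>

definition EN :: "('k, 'm) ring_scheme \<Rightarrow> real \<Rightarrow> ('k, 'v) pmod \<Rightarrow> ('k, 'v) pmod set" where
  "EN K \<delta> M = {R. persistence_module K R \<and>
     (\<exists>M\<^sub>1 M\<^sub>2. pm_submodule K M\<^sub>1 M \<and> pm_submodule K M\<^sub>2 M \<and> (\<forall>p. M\<^sub>2 p \<subseteq> M\<^sub>1 p) \<and>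
        (\<forall>p. pm_Im \<delta> M p \<subseteq> M\<^sub>1 p) \<and> (\<forall>p. M\<^sub>2 p \<subseteq> pm_Ker \<delta> M p) \<and>
        pm_iso K R (pm_quotient (pm_restrict M M\<^sub>1) M\<^sub>2))}"

end

theory Submission
  imports Defs
begin

text \<open>
  All four modules are filtrations of the space \<open>V = K\<^sup>2\<^sup>n\<close>: the space at \<open>p\<close> is a subspace \<open>M p\<close> of \<open>V\<close>,
  growing with \<open>p\<close>, and all maps are inclusions.

  \<^emph>\<open>The interleaving.\<close> Let \<open>f\<close> be a linear endomorphism of \<open>V\<close> with \<open>f (M p) \<subseteq> M (p + (2, 2))\<close>, so
  that \<open>f\<close> is a morphism of shift \<open>2\<close>. The block matrix with rows \<open>f\<close>, \<open>1\<close> and \<open>f - f\<^sup>2\<close>, \<open>1 - f\<close> is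
  idempotent, so although \<open>f\<close> itself is not idempotent, it is a corner of an idempotent on a larger
  module. The image of that idempotent is a copy of \<open>f V\<close>, the image of its complement a copy
  of \<open>(1 - f) V\<close>. With \<open>A \<supseteq> f V\<close> and \<open>B \<supseteq> (1 - f) V\<close> this yields a \<open>1\<close>-interleaving of
  \<open>M \<oplus> Q\<close> with \<open>N\<^sub>1 \<oplus> N\<^sub>2\<close>, where \<open>Q\<close>, \<open>N\<^sub>1\<close>, \<open>N\<^sub>2\<close> are shifts of \<open>M\<close> cut down to \<open>A \<inter> B\<close>, \<open>A\<close>, \<open>B\<close>
  (\<open>interleaved_filt\<close>). If neither \<open>f\<close> nor \<open>1 - f\<close> is surjective, \<open>A\<close> and \<open>B\<close> can be taken proper, so
  \<open>Q\<close>, \<open>N\<^sub>1\<close>, \<open>N\<^sub>2\<close> have pointwise dimension at most \<open>2 n - 1\<close>.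

  \<^emph>\<open>The obstruction.\<close> The maps of \<open>M\<close> are injective, so an element of the erosion neighborhood is a
  filtration \<open>T\<close> of \<open>V\<close> with \<open>M (p - (\<delta>, \<delta>)) \<subseteq> T p \<subseteq> M p\<close> (\<open>EN_filt\<close>). If every such \<open>T\<close> is
  indecomposable, then it is its own only summand, it has dimension \<open>2 n\<close> far out, and hence it is a
  subquotient of neither \<open>N\<^sub>1\<close> nor \<open>N\<^sub>2\<close>. A decomposition of \<open>T\<close> gives an idempotent \<open>\<pi>\<close> of \<open>V\<close> that
  preserves every \<open>T p\<close>, so that \<open>\<pi> (M (p - (\<delta>, \<delta>))) \<subseteq> M p\<close>; the filtration \<open>M\<close> has to be such that
  this forces \<open>\<pi> = 0\<close> or \<open>\<pi> = 1\<close>.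

  \<^emph>\<open>The filtration.\<close> The operator \<open>f\<close> is nilpotent modulo its eigenvector \<open>e\<^sub>d\<close>, \<open>d = 2 n - 1\<close>, of
  eigenvalue \<open>1\<close>, and the orbit \<open>e\<^sub>0, e\<^sub>2, e\<^sub>4, \<dots>\<close> of \<open>e\<^sub>0\<close> reaches \<open>e\<^sub>d\<close> only after \<open>n\<close> steps. Six
  \<open>f\<close>-invariant subspaces, the frame, are imposed on \<open>M\<close> near six incomparable, widely separated
  points; being constant there, they survive erosion, and \<open>\<pi>\<close> preserves each of them. Modulo \<open>e\<^sub>d\<close>
  this makes \<open>\<pi>\<close> commute with a full nilpotent shift of length \<open>d\<close>, so \<open>\<pi>\<close> is \<open>0\<close> or \<open>1\<close> modulo \<open>e\<^sub>d\<close>;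
  passing to \<open>1 - \<pi>\<close> one may assume the former. Since \<open>\<pi>\<close> also preserves \<open>(1 - f) V\<close>, which meets the
  line of \<open>e\<^sub>d\<close> trivially, \<open>\<pi> = \<pi> f\<close>, and all of \<open>\<pi>\<close> is determined by \<open>\<pi> e\<^sub>0\<close>, a multiple
  of \<open>e\<^sub>d\<close>. The algebra generated by \<open>f\<close> does contain a nontrivial idempotent, and the frame cannot
  exclude it. It is excluded near the origin, where \<open>M\<close> at \<open>(t, t)\<close> contains \<open>e\<^sub>k\<close> only for \<open>k \<le> t\<close>: there
  \<open>\<pi> e\<^sub>0\<close> may involve \<open>e\<^sub>k\<close> only for \<open>k \<le> \<delta> < d\<close>, so \<open>\<pi> e\<^sub>0 = 0\<close> (\<open>frame_projection_trivial\<close>).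
\<close>

section \<open>Dimensions of subspaces\<close>

lemma (in vectorspace) subspace_iff:
  "VectorSpace.subspace K W V \<longleftrightarrow> W \<subseteq> carrier V \<and> \<zero>\<^bsub>V\<^esub> \<in> W \<and>
     (\<forall>x\<in>W. \<forall>y\<in>W. x \<oplus>\<^bsub>V\<^esub> y \<in> W) \<and> (\<forall>c\<in>carrier K. \<forall>x\<in>W. c \<odot>\<^bsub>V\<^esub> x \<in> W)"
  using vectorspace_axioms module_axioms
  by (auto simp: VectorSpace.subspace_def submodule_def)

lemma (in vectorspace) subspace_Int:
  "VectorSpace.subspace K A V \<Longrightarrow> VectorSpace.subspace K B V \<Longrightarrow> VectorSpace.subspace K (A \<inter> B) V"
  by (auto simp: subspace_iff)

lemma (in vectorspace) subspace_uminus: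
  assumes "VectorSpace.subspace K W V" "x \<in> W" shows "\<ominus>\<^bsub>V\<^esub> x \<in> W"
proof -
  have "x \<in> carrier V" using assms by (auto simp: subspace_iff)
  then have "\<ominus>\<^bsub>V\<^esub> x = (\<ominus>\<^bsub>K\<^esub> \<one>\<^bsub>K\<^esub>) \<odot>\<^bsub>V\<^esub> x" by (simp add: smult_minus_1)
  then show ?thesis using assms by (auto simp: subspace_iff)
qed

lemma (in vectorspace) subspace_minus:
  assumes "VectorSpace.subspace K W V" "x \<in> W" "y \<in> W" shows "x \<ominus>\<^bsub>V\<^esub> y \<in> W"
  using subspace_uminus[OF assms(1,3)] assms by (auto simp: subspace_iff a_minus_def)

text \<open>
  A maximal subset of \<open>W\<close> that is linearly independent in \<open>W\<close> exists because independence in \<open>W\<close> and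
  in \<open>V\<close> coincide, which bounds its size by \<open>dim\<close>.
\<close>

lemma (in vectorspace) subspace_basis:
  assumes fd: "fin_dim" and W: "VectorSpace.subspace K W V"
  obtains B where "finite B" "B \<subseteq> W" "lin_indpt B" "vectorspace.basis K (vs W) B"
proof -
  interpret W: vectorspace K "vs W" by (rule subspace_is_vs[OF W])
  have sub: "submodule K W V" using W by simp
  have WV: "W \<subseteq> carrier V" using W by (simp add: subspace_iff)
  have li: "lin_indpt S" if "S \<subseteq> W" "W.lin_indpt S" for S
    using span_li_not_depend(2)[OF that(1) sub] that(2) by simp
  have "\<exists>B. finite B \<and> maximal B (\<lambda>S. S \<subseteq> carrier (vs W) \<and> W.lin_indpt S)"
  proof (rule maximal_exists)
    show "{} \<subseteq> carrier (vs W) \<and> W.lin_indpt {}"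
      by (simp add: W.finite_lin_indpt2)
    show "finite S \<and> card S \<le> dim" if "S \<subseteq> carrier (vs W) \<and> W.lin_indpt S" for S
      using li_le_dim[OF fd _ li[of S]] that WV by auto
  qed
  then obtain B where "finite B" "maximal B (\<lambda>S. S \<subseteq> carrier (vs W) \<and> W.lin_indpt S)" by auto
  then have "W.basis B" by (intro W.max_li_is_basis)
  then show thesis using that[of B] \<open>finite B\<close> li[of B] by (auto simp: W.basis_def)
qed

lemma (in vectorspace) subspace_fin_dim:
  assumes "fin_dim" "VectorSpace.subspace K W V" shows "vectorspace.fin_dim K (vs W)"
proof -
  interpret W: vectorspace K "vs W" by (rule subspace_is_vs[OF assms(2)])
  show ?thesis using subspace_basis[OF assms] unfolding W.fin_dim_def W.basis_def by metis
qed

lemma (in vectorspace) proper_subspace_dim_less: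
  assumes fd: "fin_dim" and W: "VectorSpace.subspace K W V" and ne: "W \<noteq> carrier V"
  shows "vectorspace.dim K (vs W) < dim"
proof -
  interpret W: vectorspace K "vs W" by (rule subspace_is_vs[OF W])
  obtain B where B: "finite B" "B \<subseteq> W" "lin_indpt B" "W.basis B"
    using subspace_basis[OF fd W] by blast
  have WV: "W \<subseteq> carrier V" using W by (simp add: subspace_iff)
  have "\<not> dim \<le> card B"
  proof
    assume "dim \<le> card B"
    then have "basis B" using dim_li_is_basis[OF fd B(1) _ B(3)] B(2) WV by auto
    then have "carrier V = span B" by (simp add: basis_def)
    also have "\<dots> \<subseteq> W" using B(2) W by (intro span_is_subset) (auto)
    finally show False using WV ne by auto
  qed
  then show ?thesis using W.dim_basis[OF B(1,4)] by simp
qed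

text \<open>
  By rank-nullity the image of \<open>T\<close> has dimension at most that of \<open>W\<close>, which is less than that of \<open>V\<close>.
\<close>

lemma (in vectorspace) no_surj_from_proper_subspace:
  assumes fd: "fin_dim" and W: "VectorSpace.subspace K W V" and ne: "W \<noteq> carrier V"
    and T: "T \<in> LinearCombinations.module_hom K (vs W) V" and surj: "T ` W = carrier V"
  shows False
proof -
  interpret W: vectorspace K "vs W" by (rule subspace_is_vs[OF W])
  interpret T: linear_map K "vs W" V T
    using T by unfold_locales (auto simp: mod_hom_axioms_def)
  have "vectorspace.dim K (vs T.im) + vectorspace.dim K (W.vs T.ker) = W.dim"
    by (rule T.rank_nullity[OF subspace_fin_dim[OF fd W]])
  moreover have "T.im = carrier V" using surj by (simp add: T.im_def)
  ultimately have "dim \<le> W.dim" by simp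
  then show False using proper_subspace_dim_less[OF fd W ne] by simp
qed

section \<open>Coordinate space\<close>

locale coord_space = field K for K :: "('k, 'm) ring_scheme" (structure) +
  fixes N :: nat
begin

definition V :: "('k, nat \<Rightarrow> 'k) module" where "V = func_space {..<N}"

definition e :: "nat \<Rightarrow> nat \<Rightarrow> 'k" where "e i = (\<lambda>k\<in>{..<N}. if k = i then \<one> else \<zero>)"

sublocale V: vectorspace K V
  using func_space_is_module[of "{..<N}"] field_axioms
  unfolding V_def vectorspace_def by blast

lemma carrier_V: "x \<in> carrier V \<longleftrightarrow> (\<forall>k<N. x k \<in> carrier K) \<and> (\<forall>k\<ge>N. x k = undefined)"
  by (auto simp: V_def func_space_def PiE_iff extensional_def)

lemma coord_closed [simp]: "x \<in> carrier V \<Longrightarrow> k < N \<Longrightarrow> x k \<in> carrier K"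
  by (simp add: carrier_V)

lemma coord_add [simp]: "k < N \<Longrightarrow> (x \<oplus>\<^bsub>V\<^esub> y) k = x k \<oplus> y k"
  and coord_zero [simp]: "k < N \<Longrightarrow> \<zero>\<^bsub>V\<^esub> k = \<zero>"
  and coord_smult [simp]: "k < N \<Longrightarrow> (c \<odot>\<^bsub>V\<^esub> x) k = c \<otimes> x k"
  by (simp_all add: V_def func_space_def)

lemma V_eqI: "x \<in> carrier V \<Longrightarrow> y \<in> carrier V \<Longrightarrow> (\<And>k. k < N \<Longrightarrow> x k = y k) \<Longrightarrow> x = y"
  by (rule ext) (metis carrier_V not_le)

lemma coord_uminus [simp]:
  assumes "k < N" "x \<in> carrier V" shows "(\<ominus>\<^bsub>V\<^esub> x) k = \<ominus> x k"
proof -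
  have "(x \<oplus>\<^bsub>V\<^esub> (\<ominus>\<^bsub>V\<^esub> x)) k = \<zero>" using assms by (simp add: V.r_neg)
  then have "x k \<oplus> (\<ominus>\<^bsub>V\<^esub> x) k = \<zero>" using assms by simp
  then have "(\<ominus>\<^bsub>V\<^esub> x) k \<oplus> x k = \<zero>" using assms by (simp add: a_comm)
  then show ?thesis using assms minus_equality[of "(\<ominus>\<^bsub>V\<^esub> x) k" "x k"] by simp
qed

lemma coord_minus [simp]:
  "k < N \<Longrightarrow> x \<in> carrier V \<Longrightarrow> y \<in> carrier V \<Longrightarrow> (x \<ominus>\<^bsub>V\<^esub> y) k = x k \<ominus> y k"
  by (simp add: a_minus_def)

lemma e_closed [simp]: "e i \<in> carrier V"
  by (simp add: carrier_V e_def)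

lemma coord_e [simp]: "k < N \<Longrightarrow> e i k = (if k = i then \<one> else \<zero>)"
  by (simp add: e_def)

lemma coord_lincomb:
  assumes "finite A" "A \<subseteq> carrier V" "a \<in> A \<rightarrow> carrier K" "k < N"
  shows "V.lincomb a A k = (\<Oplus>v\<in>A. a v \<otimes> v k)"
  using assms
proof (induction A rule: finite_induct)
  case empty
  then show ?case by (simp add: V.lincomb_def)
next
  case (insert v A)
  have "V.lincomb a (insert v A) = (a v \<odot>\<^bsub>V\<^esub> v) \<oplus>\<^bsub>V\<^esub> V.lincomb a A"
    unfolding V.lincomb_def by (rule V.finsum_insert) (use insert in auto)
  moreover have "(\<Oplus>w\<in>insert v A. a w \<otimes> w k) = a v \<otimes> v k \<oplus> (\<Oplus>w\<in>A. a w \<otimes> w k)"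
    by (rule finsum_insert) (use insert in \<open>auto simp: Pi_iff subset_iff\<close>)
  ultimately show ?case using insert by simp
qed

lemma inj_e: "inj_on e {..<N}"
  by (rule inj_onI) (metis coord_e lessThan_iff one_not_zero)

text \<open>
  The linear combination of the unit vectors with coefficients \<open>a (e k)\<close> has these coefficients as its
  coordinates; both halves of \<open>basis_e\<close> follow from this.
\<close>

lemma coord_lincomb_e:
  assumes "a \<in> e ` {..<N} \<rightarrow> carrier K" "k < N"
  shows "V.lincomb a (e ` {..<N}) k = a (e k)"
proof -
  have ae [simp]: "a (e i) \<in> carrier K" if "i < N" for i using assms(1) that by auto
  have "V.lincomb a (e ` {..<N}) k = (\<Oplus>v\<in>e ` {..<N}. a v \<otimes> v k)"
    using assms by (intro coord_lincomb) auto
  also have "\<dots> = (\<Oplus>i\<in>{..<N}. a (e i) \<otimes> e i k)"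
    by (rule finsum_reindex[OF _ inj_e]) (use assms in auto)
  also have "\<dots> = (\<Oplus>i\<in>{..<N}. if k = i then a (e i) else \<zero>)"
    using assms by (intro finsum_cong') auto
  also have "\<dots> = a (e k)"
    by (rule finsum_singleton) (use assms in auto)
  finally show ?thesis .
qed

lemma basis_e: "V.basis (e ` {..<N})"
  unfolding V.basis_def
proof (intro conjI)
  show sub: "e ` {..<N} \<subseteq> carrier V" by auto
  show "V.lin_indpt (e ` {..<N})"
  proof (rule V.finite_lin_indpt2)
    fix a assume a: "a \<in> e ` {..<N} \<rightarrow> carrier K" and z: "V.lincomb a (e ` {..<N}) = \<zero>\<^bsub>V\<^esub>"
    show "\<forall>v\<in>e ` {..<N}. a v = \<zero>"
      using coord_lincomb_e[OF a] unfolding z by auto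
  qed (use sub in auto)
  have "x \<in> V.span (e ` {..<N})" if x: "x \<in> carrier V" for x
  proof -
    define a where "a v = x (the_inv_into {..<N} e v)" for v
    have ae: "a (e i) = x i" if "i < N" for i
      using that inj_e by (simp add: a_def the_inv_into_f_f)
    then have a: "a \<in> e ` {..<N} \<rightarrow> carrier K" using x by auto
    have "V.lincomb a (e ` {..<N}) = x"
      using a ae x sub by (intro V_eqI) (auto simp: coord_lincomb_e intro!: V.lincomb_closed)
    then show ?thesis unfolding V.span_def
      using a by (intro CollectI exI[of _ a] exI[of _ "e ` {..<N}"]) simp
  qed
  then show "V.gen_set (e ` {..<N})" using V.span_is_subset2[OF sub] by auto
qed

lemma fin_dim_V: "V.fin_dim" and dim_V: "V.dim = N"
proof -
  show "V.fin_dim" 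
    using basis_e unfolding V.fin_dim_def V.basis_def by (intro exI[of _ "e ` {..<N}"]) simp
  show "V.dim = N" using V.dim_basis[OF _ basis_e] by (simp add: card_image[OF inj_e])
qed

end

section \<open>Isomorphisms, indecomposability and barcodes\<close>

lemma module_hom_iff:
  "f \<in> LinearCombinations.module_hom K V W \<longleftrightarrow> f \<in> carrier V \<rightarrow> carrier W \<and>
     (\<forall>x\<in>carrier V. \<forall>y\<in>carrier V. f (x \<oplus>\<^bsub>V\<^esub> y) = f x \<oplus>\<^bsub>W\<^esub> f y) \<and>
     (\<forall>c\<in>carrier K. \<forall>x\<in>carrier V. f (c \<odot>\<^bsub>V\<^esub> x) = c \<odot>\<^bsub>W\<^esub> f x)"
  by (auto simp: LinearCombinations.module_hom_def)

lemma pm_homI: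
  assumes "\<And>p x. x \<in> carrier (pm_space M p) \<Longrightarrow> f p x \<in> carrier (pm_space N p)"
    and "\<And>p x y. x \<in> carrier (pm_space M p) \<Longrightarrow> y \<in> carrier (pm_space M p) \<Longrightarrow>
        f p (x \<oplus>\<^bsub>pm_space M p\<^esub> y) = f p x \<oplus>\<^bsub>pm_space N p\<^esub> f p y"
    and "\<And>p c x. c \<in> carrier K \<Longrightarrow> x \<in> carrier (pm_space M p) \<Longrightarrow>
        f p (c \<odot>\<^bsub>pm_space M p\<^esub> x) = c \<odot>\<^bsub>pm_space N p\<^esub> f p x"
    and "\<And>p q x. p \<le> q \<Longrightarrow> x \<in> carrier (pm_space M p) \<Longrightarrow>
        f q (pm_map M p q x) = pm_map N p q (f p x)"
  shows "f \<in> pm_hom K M N"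
  unfolding pm_hom_def module_hom_iff
  by (intro CollectI conjI allI impI ballI Pi_I) (fact assms)+

lemma
  assumes "f \<in> pm_hom K M N"
  shows pm_hom_closed: "x \<in> carrier (pm_space M p) \<Longrightarrow> f p x \<in> carrier (pm_space N p)"
    and pm_hom_add: "x \<in> carrier (pm_space M p) \<Longrightarrow> y \<in> carrier (pm_space M p) \<Longrightarrow>
        f p (x \<oplus>\<^bsub>pm_space M p\<^esub> y) = f p x \<oplus>\<^bsub>pm_space N p\<^esub> f p y"
    and pm_hom_smult: "c \<in> carrier K \<Longrightarrow> x \<in> carrier (pm_space M p) \<Longrightarrow>
        f p (c \<odot>\<^bsub>pm_space M p\<^esub> x) = c \<odot>\<^bsub>pm_space N p\<^esub> f p x"
    and pm_hom_natural: "p \<le> q \<Longrightarrow> x \<in> carrier (pm_space M p) \<Longrightarrow>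
        f q (pm_map M p q x) = pm_map N p q (f p x)"
  using assms unfolding pm_hom_def module_hom_iff by blast+

lemma pm_hom_comp:
  assumes "f \<in> pm_hom K M N" "g \<in> pm_hom K N L"
  shows "(\<lambda>p x. g p (f p x)) \<in> pm_hom K M L"
  using pm_hom_closed[OF assms(1)] pm_hom_add[OF assms(1)] pm_hom_smult[OF assms(1)]
    pm_hom_natural[OF assms(1)] pm_hom_closed[OF assms(2)] pm_hom_add[OF assms(2)]
    pm_hom_smult[OF assms(2)] pm_hom_natural[OF assms(2)]
  by (intro pm_homI) simp_all

lemma pm_iso_trans:
  assumes "pm_iso K M N" "pm_iso K N L" shows "pm_iso K M L"
proof -
  obtain f g where fg: "f \<in> pm_hom K M N" "g \<in> pm_hom K N M"
    "\<And>p x. x \<in> carrier (pm_space M p) \<Longrightarrow> g p (f p x) = x"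
    "\<And>p y. y \<in> carrier (pm_space N p) \<Longrightarrow> f p (g p y) = y"
    using assms(1) unfolding pm_iso_def by blast
  obtain h k where hk: "h \<in> pm_hom K N L" "k \<in> pm_hom K L N"
    "\<And>p x. x \<in> carrier (pm_space N p) \<Longrightarrow> k p (h p x) = x"
    "\<And>p y. y \<in> carrier (pm_space L p) \<Longrightarrow> h p (k p y) = y"
    using assms(2) unfolding pm_iso_def by blast
  show ?thesis
    unfolding pm_iso_def
    using pm_hom_comp[OF fg(1) hk(1)] pm_hom_comp[OF hk(2) fg(2)]
      pm_hom_closed[OF fg(1)] pm_hom_closed[OF hk(2)] fg(3,4) hk(3,4)
    by (intro bexI[of _ "\<lambda>p x. h p (f p x)"] bexI[of _ "\<lambda>p x. g p (k p x)"]) auto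
qed

lemma pm_iso_sym: "pm_iso K M N \<Longrightarrow> pm_iso K N M"
  unfolding pm_iso_def by blast

lemma pm_iso_refl: "pm_iso K M M"
  unfolding pm_iso_def
  by (intro bexI[of _ "\<lambda>p x. x"] allI conjI ballI pm_homI) simp_all

lemma indecomposable_iso:
  fixes R M :: "('k, 'v) pmod"
  assumes "pm_iso K R M" "indecomposable K M" "persistence_module K R"
  shows "indecomposable K R"
proof -
  have "\<not> zero_pmod R"
  proof
    assume z: "zero_pmod R"
    obtain f g where fg: "f \<in> pm_hom K R M" "g \<in> pm_hom K M R"
      "\<And>p y. y \<in> carrier (pm_space M p) \<Longrightarrow> f p (g p y) = y"
      using assms(1) unfolding pm_iso_def by blast
    have "x = \<zero>\<^bsub>pm_space M p\<^esub>" if x: "x \<in> carrier (pm_space M p)" for x p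
    proof -
      interpret Mp: vectorspace K "pm_space M p"
        using assms(2) by (auto simp: indecomposable_def intro: persistence_module.vectorspace_pm_space)
      have "g p y = \<zero>\<^bsub>pm_space R p\<^esub>" if "y \<in> carrier (pm_space M p)" for y
        using pm_hom_closed[OF fg(2) that] z unfolding zero_pmod_def by blast
      then show ?thesis using fg(3)[of _ p] x Mp.zero_closed by metis
    qed
    moreover have "\<zero>\<^bsub>pm_space M p\<^esub> \<in> carrier (pm_space M p)" for p
    proof -
      interpret Mp: vectorspace K "pm_space M p"
        using assms(2) by (auto simp: indecomposable_def intro: persistence_module.vectorspace_pm_space)
      show ?thesis by simp
    qed
    ultimately have "zero_pmod M" unfolding zero_pmod_def by auto
    then show False using assms(2) by (simp add: indecomposable_def)
  qed
  then show ?thesis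
    using assms pm_iso_trans[OF pm_iso_sym[OF assms(1)]] unfolding indecomposable_def by blast
qed

text \<open>
  An indecomposable module is the direct sum of the one-member family consisting of itself.
\<close>

lemma indecomposable_in_barcode:
  assumes R: "indecomposable K R"
  shows "R \<in> barcode K R"
proof -
  have per: "persistence_module K R" using R by (simp add: indecomposable_def)
  define i :: "(real \<times> real) \<times> nat" where "i = ((0, 0), 0)"
  have cl: "x \<oplus>\<^bsub>pm_space R p\<^esub> y \<in> carrier (pm_space R p)" "c \<odot>\<^bsub>pm_space R p\<^esub> x \<in> carrier (pm_space R p)"
    if "x \<in> carrier (pm_space R p)" "y \<in> carrier (pm_space R p)" "c \<in> carrier K" for x y c p
  proof -
    interpret Rp: vectorspace K "pm_space R p"
      using per by (rule persistence_module.vectorspace_pm_space)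
    show "x \<oplus>\<^bsub>pm_space R p\<^esub> y \<in> carrier (pm_space R p)" "c \<odot>\<^bsub>pm_space R p\<^esub> x \<in> carrier (pm_space R p)"
      using that by auto
  qed
  have "pm_iso K R (pm_family_sum {i} (\<lambda>_. R))"
    unfolding pm_iso_def
    by (intro bexI[of _ "\<lambda>p x. \<lambda>_\<in>{i}. x"] bexI[of _ "\<lambda>p x. x i"])
       (auto intro!: pm_homI simp: pm_family_sum_def family_sum_def PiE_iff
          extensional_def restrict_def fun_eq_iff cl)
  then have "barcode_family K R {i} (\<lambda>_. R)" using R by (simp add: barcode_family_def)
  then show ?thesis using per pm_iso_refl unfolding barcode_def by blast
qed

section \<open>Filtrations\<close>

text \<open>
  The two coordinates of the identity that makes the maps of \<open>interleaved_filt\<close> mutually inverse up to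
  shift, with the values of the endomorphism abstracted to independent elements.
\<close>

lemma (in abelian_group) add_minus_cancel1:
  assumes "a \<in> carrier G" "v \<in> carrier G" "w \<in> carrier G"
  shows "(a \<oplus> w) \<oplus> ((v \<ominus> a) \<ominus> w) = v"
  using assms by (simp add: minus_eq minus_add a_ac r_neg r_neg1 r_neg2)

lemma (in abelian_group) add_minus_cancel2:
  assumes "a \<in> carrier G" "b \<in> carrier G" "c \<in> carrier G" "w \<in> carrier G"
  shows "(a \<oplus> w) \<ominus> (c \<oplus> b) \<ominus> ((a \<ominus> c) \<ominus> b) = w"
proof -
  have *: "(a \<oplus> w) \<ominus> (c \<oplus> b) = w \<oplus> ((a \<ominus> c) \<ominus> b)"
    using assms by (simp add: minus_eq minus_add a_ac)
  show ?thesis using assms unfolding * by (simp add: minus_eq a_assoc r_neg)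
qed

definition filt :: "('k, 'v) module \<Rightarrow> (real \<times> real \<Rightarrow> 'v set) \<Rightarrow> ('k, 'v) pmod" where
  "filt V S = \<lparr>pm_space = (\<lambda>p. V\<lparr>carrier := S p\<rparr>), pm_map = (\<lambda>p q x. x)\<rparr>"

locale filtration = vectorspace K V for K :: "('k, 'm) ring_scheme" and V :: "('k, 'v) module" +
  fixes S :: "real \<times> real \<Rightarrow> 'v set"
  assumes sub: "VectorSpace.subspace K (S p) V" and incr: "p \<le> q \<Longrightarrow> S p \<subseteq> S q"
begin

lemma S_carrier: "x \<in> S p \<Longrightarrow> x \<in> carrier V"
  using sub[of p] by (auto simp: subspace_iff)

lemma persistence_module_filt: "persistence_module K (filt V S)"
proof (rule persistence_module.intro, goal_cases)
  case (2 p q)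
  then show ?case using incr[of p q] by (auto simp: filt_def module_hom_iff)
qed (simp_all add: filt_def subspace_is_vs[OF sub])

lemma pfd_filt: "fin_dim \<Longrightarrow> pfd K (filt V S)"
  using persistence_module_filt subspace_fin_dim[OF _ sub] by (simp add: pfd_def filt_def)

end

section \<open>A one-interleaving from an endomorphism of shift two\<close>

text \<open>
  The maps are \<open>(v, w) \<mapsto> (f v + w, (v - f v) - w)\<close> and \<open>(u, u') \<mapsto> (u + u', (u - f u) - f u')\<close>. They are
  inverse to each other on \<open>V \<times> V\<close>, for any linear \<open>f\<close>: the idempotent is the product of the column
  \<open>(1, 1 - f)\<close> and the row \<open>(f, 1)\<close>, its complement that of \<open>(1, - f)\<close> and \<open>(1 - f, - 1)\<close>. The shifts by
  \<open>2\<close> and \<open>1\<close> in the three companions of \<open>S\<close> make both maps morphisms of shift \<open>1\<close>, and \<open>A\<close>, \<open>B\<close>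
  are invariant under \<open>f\<close> and \<open>1 - f\<close> because they contain the respective image.
\<close>

lemma (in filtration) interleaved_filt:
  assumes f: "f \<in> LinearCombinations.module_hom K V V"
    and fS: "\<And>p x. x \<in> S p \<Longrightarrow> f x \<in> S (p + (2, 2))"
    and A: "VectorSpace.subspace K A V" and B: "VectorSpace.subspace K B V"
    and fA: "\<And>x. x \<in> carrier V \<Longrightarrow> f x \<in> A"
    and fB: "\<And>x. x \<in> carrier V \<Longrightarrow> x \<ominus>\<^bsub>V\<^esub> f x \<in> B"
  shows "interleaved K 1 (pm_sum (filt V S) (filt V (\<lambda>p. S (p + (2, 2)) \<inter> A \<inter> B)))
     (pm_sum (filt V (\<lambda>p. S (p + (1, 1)) \<inter> A)) (filt V (\<lambda>p. S (p + (1, 1)) \<inter> B)))"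
proof -
  have S_sub: "S p \<subseteq> carrier V" for p using S_carrier by blast
  have A_sub: "A \<subseteq> carrier V" and B_sub: "B \<subseteq> carrier V"
    using A B by (auto simp: subspace_iff)
  have f_cl [simp]: "f x \<in> carrier V" if "x \<in> carrier V" for x
    using f that by (auto simp: module_hom_iff)
  have f_add [simp]: "f (x \<oplus>\<^bsub>V\<^esub> y) = f x \<oplus>\<^bsub>V\<^esub> f y" if "x \<in> carrier V" "y \<in> carrier V" for x y
    using f that by (auto simp: module_hom_iff)
  have f_smult [simp]: "f (c \<odot>\<^bsub>V\<^esub> x) = c \<odot>\<^bsub>V\<^esub> f x" if "c \<in> carrier K" "x \<in> carrier V" for x c
    using f that by (auto simp: module_hom_iff)
  interpret f: mod_hom K V V f by unfold_locales (fact f)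
  have shift2: "p + (1, 1) + (1, 1) = p + (2, 2)" "p + (2, 2) + (1, 1) = p + (1, 1) + (2, 2)" for p :: "real \<times> real"
    by (cases p; simp)+
  define \<phi> where "\<phi> = (\<lambda>(p :: real \<times> real) (v, w). (f v \<oplus>\<^bsub>V\<^esub> w, (v \<ominus>\<^bsub>V\<^esub> f v) \<ominus>\<^bsub>V\<^esub> w))"
  define \<psi> where "\<psi> = (\<lambda>(p :: real \<times> real) (u, u'). (u \<oplus>\<^bsub>V\<^esub> u', (u \<ominus>\<^bsub>V\<^esub> f u) \<ominus>\<^bsub>V\<^esub> f u'))"
  note sum_defs = pm_sum_def filt_def pm_shift_def direct_sum_def
  have cl: "x \<in> S p \<Longrightarrow> x \<in> carrier V" "x \<in> A \<Longrightarrow> x \<in> carrier V" "x \<in> B \<Longrightarrow> x \<in> carrier V" for x p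
    using S_sub A_sub B_sub by blast+
  have fA2: "f x \<oplus>\<^bsub>V\<^esub> y \<in> A" if "x \<in> carrier V" "y \<in> A" for x y
    using fA A that by (auto simp: subspace_iff)
  have fB2: "(x \<ominus>\<^bsub>V\<^esub> f x) \<ominus>\<^bsub>V\<^esub> y \<in> B" if "x \<in> carrier V" "y \<in> B" for x y
    using subspace_minus[OF B fB that(2)] that by auto
  have id_f_A: "x \<ominus>\<^bsub>V\<^esub> f x \<in> A" if "x \<in> A" for x
    using subspace_minus[OF A that fA] that by (simp add: cl)
  have id_f_f_A: "x \<ominus>\<^bsub>V\<^esub> f x \<ominus>\<^bsub>V\<^esub> f y \<in> A" if "x \<in> A" "y \<in> carrier V" for x y
    using subspace_minus[OF A id_f_A fA] that by simp
  have f_B: "f x \<in> B" if "x \<in> B" for x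
  proof -
    have "x \<ominus>\<^bsub>V\<^esub> (x \<ominus>\<^bsub>V\<^esub> f x) = f x"
      using that by (simp add: cl a_minus_def minus_add a_assoc[symmetric] r_neg)
    then show ?thesis using subspace_minus[OF B that fB[of x]] that by (simp add: cl)
  qed
  have S_add: "x \<oplus>\<^bsub>V\<^esub> y \<in> S p" and S_minus: "x \<ominus>\<^bsub>V\<^esub> y \<in> S p" if "x \<in> S p" "y \<in> S p" for x y p
    using sub[of p] subspace_minus[OF sub that] that by (auto simp: subspace_iff)
  have up: "x \<in> S (p + (2, 2))" if "x \<in> S p" for x p
    using incr[of p "p + (2, 2)"] that by (cases p) auto
  have \<phi>: "\<phi> \<in> pm_hom K (pm_sum (filt V S) (filt V (\<lambda>p. S (p + (2, 2)) \<inter> A \<inter> B)))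
     (pm_shift 1 (pm_sum (filt V (\<lambda>p. S (p + (1, 1)) \<inter> A)) (filt V (\<lambda>p. S (p + (1, 1)) \<inter> B))))"
  proof (rule pm_homI, goal_cases)
    case (1 p x)
    then show ?case
      by (cases x) (auto simp: \<phi>_def sum_defs shift2 fA fA2 fB2 id_f_A id_f_f_A f_B fS S_add S_minus cl
          intro!: S_add S_minus intro: up)
  next
    case (2 p x y)
    then show ?case
      by (cases x; cases y) (auto simp: \<phi>_def sum_defs cl minus_eq minus_add a_ac)
  next
    case (3 p c x)
    then show ?case
      by (cases x) (auto simp: \<phi>_def sum_defs cl minus_eq smult_r_distr smult_r_minus)
  next
    case (4 p q x)
    then show ?case
      by (cases x) (auto simp: \<phi>_def sum_defs)
  qed
  have \<psi>: "\<psi> \<in> pm_hom K (pm_sum (filt V (\<lambda>p. S (p + (1, 1)) \<inter> A)) (filt V (\<lambda>p. S (p + (1, 1)) \<inter> B)))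
     (pm_shift 1 (pm_sum (filt V S) (filt V (\<lambda>p. S (p + (2, 2)) \<inter> A \<inter> B))))"
  proof (rule pm_homI, goal_cases)
    case (1 p x)
    then show ?case
      by (cases x) (auto simp: \<psi>_def sum_defs shift2 fA fA2 fB2 id_f_A id_f_f_A f_B fS S_add S_minus cl
          intro!: S_add S_minus intro: up)
  next
    case (2 p x y)
    then show ?case
      by (cases x; cases y) (auto simp: \<psi>_def sum_defs cl minus_eq minus_add a_ac)
  next
    case (3 p c x)
    then show ?case
      by (cases x) (auto simp: \<psi>_def sum_defs cl minus_eq smult_r_distr smult_r_minus)
  next
    case (4 p q x)
    then show ?case
      by (cases x) (auto simp: \<psi>_def sum_defs)
  qed
  have \<psi>\<phi>: "\<psi> q (\<phi> p (v, w)) = (v, w)" if "v \<in> carrier V" "w \<in> carrier V" for v w p q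
    using that by (simp add: \<phi>_def \<psi>_def add_minus_cancel1 add_minus_cancel2)
  have \<phi>\<psi>: "\<phi> q (\<psi> p (v, w)) = (v, w)" if "v \<in> carrier V" "w \<in> carrier V" for v w p q
    using that by (simp add: \<phi>_def \<psi>_def add_minus_cancel1 add_minus_cancel2)
  show ?thesis
    unfolding interleaved_def
    using \<phi> \<psi>
    by (intro bexI[of _ \<phi>] bexI[of _ \<psi>])
       (auto simp: hom_shift_def shift_trans_def sum_defs \<phi>\<psi> \<psi>\<phi> cl)
qed

section \<open>Erosions, decompositions and subquotients of filtrations\<close>

lemma pm_hom_zero:
  assumes "persistence_module K M" "vectorspace K (pm_space N p)" "f \<in> pm_hom K M N"
  shows "f p \<zero>\<^bsub>pm_space M p\<^esub> = \<zero>\<^bsub>pm_space N p\<^esub>"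
proof -
  interpret M: vectorspace K "pm_space M p"
    using assms(1) by (rule persistence_module.vectorspace_pm_space)
  interpret N: vectorspace K "pm_space N p" by fact
  have "f p (\<zero>\<^bsub>K\<^esub> \<odot>\<^bsub>pm_space M p\<^esub> \<zero>\<^bsub>pm_space M p\<^esub>) = \<zero>\<^bsub>K\<^esub> \<odot>\<^bsub>pm_space N p\<^esub> f p \<zero>\<^bsub>pm_space M p\<^esub>"
    by (rule pm_hom_smult[OF assms(3)]) simp_all
  then show ?thesis using pm_hom_closed[OF assms(3), of "\<zero>\<^bsub>pm_space M p\<^esub>" p] by simp
qed

context filtration
begin

lemma pm_space_filt [simp]: "carrier (pm_space (filt V S) p) = S p"
  by (simp add: filt_def)

lemma zero_in [simp]: "\<zero>\<^bsub>V\<^esub> \<in> S p"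
  using sub[of p] by (simp add: subspace_iff)

text \<open>
  The cosets of the zero subspace are the singletons.
\<close>

lemma quotient_zero_iso:
  "pm_iso K (pm_quotient (filt V S) (\<lambda>p. {\<zero>\<^bsub>V\<^esub>})) (filt V S)"
proof -
  have Vp: "vectorspace K (V\<lparr>carrier := S p\<rparr>)" for p by (rule subspace_is_vs[OF sub])
  have car: "carrier (pm_space (pm_quotient (filt V S) (\<lambda>p. {\<zero>\<^bsub>V\<^esub>})) p) = (\<lambda>x. {x}) ` S p" for p
    using S_carrier
    by (auto simp: pm_quotient_def quotient_space_def filt_def A_RCOSETS_def' a_r_coset_def')
  show ?thesis
    unfolding pm_iso_def
    using S_carrier
    by (intro bexI[of _ "\<lambda>p. the_elem"] bexI[of _ "\<lambda>p x. {x}"] pm_homI)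
       (auto simp: car, auto simp: pm_quotient_def quotient_space_def filt_def set_add_def')
qed

text \<open>
  As the maps of a filtration are injective, its \<open>\<delta>\<close>-kernel is zero, so nothing is divided out; what
  remains of an element of the erosion neighborhood is a submodule between \<open>Im\<^sub>\<delta>\<close> and everything.
\<close>

lemma EN_filt:
  assumes "R \<in> EN K \<delta> (filt V S)"
  obtains T where "filtration K V T" "\<And>p. S (p + (- \<delta>, - \<delta>)) \<subseteq> T p" "\<And>p. T p \<subseteq> S p"
    "pm_iso K R (filt V T)"
proof -
  obtain T Z where TZ: "pm_submodule K T (filt V S)" "pm_submodule K Z (filt V S)"
    "\<And>p. pm_Im \<delta> (filt V S) p \<subseteq> T p" "\<And>p. Z p \<subseteq> pm_Ker \<delta> (filt V S) p"
    "pm_iso K R (pm_quotient (pm_restrict (filt V S) T) Z)"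
    using assms unfolding EN_def by blast
  have sub': "T p \<subseteq> S p" "VectorSpace.subspace K (T p) V" "\<zero>\<^bsub>V\<^esub> \<in> Z p" for p
  proof -
    interpret Vp: vectorspace K "V\<lparr>carrier := S p\<rparr>" by (rule subspace_is_vs[OF sub])
    have "VectorSpace.subspace K (T p) (V\<lparr>carrier := S p\<rparr>)" "VectorSpace.subspace K (Z p) (V\<lparr>carrier := S p\<rparr>)"
      using TZ(1,2) by (simp_all add: pm_submodule_def filt_def del: split_paired_All)
    then show "T p \<subseteq> S p" "VectorSpace.subspace K (T p) V" "\<zero>\<^bsub>V\<^esub> \<in> Z p"
      using S_carrier[of _ p] unfolding subspace_iff Vp.subspace_iff by auto
  qed
  have Z: "Z = (\<lambda>p. {\<zero>\<^bsub>V\<^esub>})"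
    using TZ(4) sub'(3) by (intro ext) (auto simp: pm_Ker_def shift_trans_def pm_shift_def filt_def)
  have R: "pm_restrict (filt V S) T = filt V T"
    by (simp add: pm_restrict_def filt_def)
  interpret T: filtration K V T
  proof (intro filtration.intro filtration_axioms.intro)
    show "T p \<subseteq> T q" if "p \<le> q" for p q
      using TZ(1) that by (simp add: pm_submodule_def filt_def image_subset_iff subset_iff del: split_paired_All)
  qed (fact vectorspace_axioms sub')+
  have "S (p + (- \<delta>, - \<delta>)) \<subseteq> T p" for p
    using TZ(3)[of p] by (simp add: pm_Im_def shift_trans_def pm_shift_def filt_def)
  moreover have "pm_iso K R (filt V T)"
    using TZ(5) pm_iso_trans T.quotient_zero_iso unfolding Z R by blast
  ultimately show thesis using that T.filtration_axioms sub'(1) by blast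
qed

text \<open>
  Let \<open>filt V S\<close> be isomorphic to \<open>A \<oplus> B\<close>. Projecting to \<open>A\<close> gives an idempotent on each \<open>S p\<close>. These are
  compatible with inclusions, so by comparison at a common upper bound of \<open>p\<close> and \<open>p\<^sub>0\<close> they are all
  restrictions of the single idempotent \<open>\<pi>\<close> of \<open>S p\<^sub>0 = V\<close>. If \<open>\<pi>\<close> is zero or the identity, then \<open>A\<close>
  respectively \<open>B\<close> vanishes at every point.
\<close>

lemma indecomposable_filt:
  assumes top: "S p\<^sub>0 = carrier V" and nz: "carrier V \<noteq> {\<zero>\<^bsub>V\<^esub>}"
    and idem: "\<And>\<pi>. \<lbrakk>\<pi> \<in> LinearCombinations.module_hom K V V; \<And>x. x \<in> carrier V \<Longrightarrow> \<pi> (\<pi> x) = \<pi> x;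
        \<And>p x. x \<in> S p \<Longrightarrow> \<pi> x \<in> S p\<rbrakk>
      \<Longrightarrow> (\<forall>x\<in>carrier V. \<pi> x = \<zero>\<^bsub>V\<^esub>) \<or> (\<forall>x\<in>carrier V. \<pi> x = x)"
  shows "indecomposable K (filt V S)"
proof -
  have zero [simp]: "\<zero>\<^bsub>pm_space (filt V S) p\<^esub> = \<zero>\<^bsub>V\<^esub>" for p by (simp add: filt_def)
  have "\<not> zero_pmod (filt V S)"
  proof
    assume "zero_pmod (filt V S)"
    then have "S p\<^sub>0 = {\<zero>\<^bsub>V\<^esub>}" by (simp add: zero_pmod_def del: split_paired_All)
    then show False using top nz by simp
  qed
  moreover have "zero_pmod A \<or> zero_pmod B"
    if A: "persistence_module K A" and B: "persistence_module K B"
      and iso: "pm_iso K (filt V S) (pm_sum A B)" for A B :: "('k, 'v) pmod"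
  proof -
    obtain f g where f: "f \<in> pm_hom K (filt V S) (pm_sum A B)" and g: "g \<in> pm_hom K (pm_sum A B) (filt V S)"
      and gf: "\<And>p x. x \<in> S p \<Longrightarrow> g p (f p x) = x"
      and fg: "\<And>p y. y \<in> carrier (pm_space (pm_sum A B) p) \<Longrightarrow> f p (g p y) = y"
      using iso unfolding pm_iso_def by auto
    have Ap: "vectorspace K (pm_space A p)" and Bp: "vectorspace K (pm_space B p)" for p
      using A B by (simp_all add: persistence_module.vectorspace_pm_space)
    have ABp: "vectorspace K (pm_space (pm_sum A B) p)" for p
      using direct_sum_is_vs[OF Ap Bp] by (simp add: pm_sum_def)
    have car: "carrier (pm_space (pm_sum A B) p) = carrier (pm_space A p) \<times> carrier (pm_space B p)" for p
      by (simp add: pm_sum_def direct_sum_def)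
    have z [simp]: "\<zero>\<^bsub>pm_space A p\<^esub> \<in> carrier (pm_space A p)" "\<zero>\<^bsub>pm_space B p\<^esub> \<in> carrier (pm_space B p)" for p
    proof -
      interpret A: vectorspace K "pm_space A p" by (rule Ap)
      interpret B: vectorspace K "pm_space B p" by (rule Bp)
      show "\<zero>\<^bsub>pm_space A p\<^esub> \<in> carrier (pm_space A p)" "\<zero>\<^bsub>pm_space B p\<^esub> \<in> carrier (pm_space B p)"
        by simp_all
    qed
    have f0: "f p \<zero>\<^bsub>V\<^esub> = (\<zero>\<^bsub>pm_space A p\<^esub>, \<zero>\<^bsub>pm_space B p\<^esub>)" for p
      using pm_hom_zero[OF persistence_module_filt ABp f] by (simp add: pm_sum_def direct_sum_def)
    have f_cl: "fst (f p x) \<in> carrier (pm_space A p)" "snd (f p x) \<in> carrier (pm_space B p)" if "x \<in> S p" for p x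
      using pm_hom_closed[OF f, of x p] that by (auto simp: car)
    have B0: "pm_map B p q \<zero>\<^bsub>pm_space B p\<^esub> = \<zero>\<^bsub>pm_space B q\<^esub>" if "p \<le> q" for p q
    proof -
      interpret Bp: vectorspace K "pm_space B p" by (rule Bp)
      interpret Bq: vectorspace K "pm_space B q" by (rule Bp)
      interpret mod_hom K "pm_space B p" "pm_space B q" "pm_map B p q"
        by unfold_locales (rule persistence_module.map_hom[OF B that])
      show ?thesis by simp
    qed
    define \<epsilon> where "\<epsilon> p x = g p (fst (f p x), \<zero>\<^bsub>pm_space B p\<^esub>)" for p x
    have \<epsilon>_cl: "\<epsilon> p x \<in> S p" if "x \<in> S p" for p x
      using pm_hom_closed[OF g, of "(fst (f p x), \<zero>\<^bsub>pm_space B p\<^esub>)" p] f_cl[OF that] by (simp add: car \<epsilon>_def)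
    have f\<epsilon>: "f p (\<epsilon> p x) = (fst (f p x), \<zero>\<^bsub>pm_space B p\<^esub>)" if "x \<in> S p" for p x
      using fg[of "(fst (f p x), \<zero>\<^bsub>pm_space B p\<^esub>)" p] f_cl[OF that] by (simp add: car \<epsilon>_def)
    have \<epsilon>_nat: "\<epsilon> q x = \<epsilon> p x" if "p \<le> q" "x \<in> S p" for p q x
    proof -
      have "f q x = pm_map (pm_sum A B) p q (f p x)"
        using pm_hom_natural[OF f that(1), of x] that(2) by (simp add: filt_def)
      then have "(fst (f q x), \<zero>\<^bsub>pm_space B q\<^esub>) = pm_map (pm_sum A B) p q (fst (f p x), \<zero>\<^bsub>pm_space B p\<^esub>)"
        using B0[OF that(1)] by (simp add: pm_sum_def)
      then show ?thesis
        using pm_hom_natural[OF g that(1), of "(fst (f p x), \<zero>\<^bsub>pm_space B p\<^esub>)"] f_cl[OF that(2)]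
        by (simp add: \<epsilon>_def car) (simp add: filt_def)
    qed
    define \<pi> where "\<pi> = \<epsilon> p\<^sub>0"
    have \<epsilon>_\<pi>: "\<epsilon> p x = \<pi> x" if x: "x \<in> S p" for p x
    proof -
      define q where "q = (max (fst p) (fst p\<^sub>0), max (snd p) (snd p\<^sub>0))"
      have q: "p \<le> q" "p\<^sub>0 \<le> q" by (simp_all add: q_def less_eq_prod_def)
      show ?thesis using \<epsilon>_nat[OF q(1) x] \<epsilon>_nat[OF q(2), of x] x S_carrier top by (simp add: \<pi>_def)
    qed
    have "(\<forall>x\<in>carrier V. \<pi> x = \<zero>\<^bsub>V\<^esub>) \<or> (\<forall>x\<in>carrier V. \<pi> x = x)"
    proof (rule idem)
      interpret B: vectorspace K "pm_space B p\<^sub>0" by (rule Bp)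
      have 1: "f p\<^sub>0 (x \<oplus>\<^bsub>V\<^esub> y) = f p\<^sub>0 x \<oplus>\<^bsub>pm_space (pm_sum A B) p\<^sub>0\<^esub> f p\<^sub>0 y"
        if "x \<in> carrier V" "y \<in> carrier V" for x y
        using pm_hom_add[OF f, of x p\<^sub>0 y] that top by (simp) (simp add: filt_def)
      have 2: "f p\<^sub>0 (c \<odot>\<^bsub>V\<^esub> x) = c \<odot>\<^bsub>pm_space (pm_sum A B) p\<^sub>0\<^esub> f p\<^sub>0 x"
        if "c \<in> carrier K" "x \<in> carrier V" for x c
        using pm_hom_smult[OF f, of c x p\<^sub>0] that top by (simp) (simp add: filt_def)
      have 3: "g p\<^sub>0 ((a, \<zero>\<^bsub>pm_space B p\<^sub>0\<^esub>) \<oplus>\<^bsub>pm_space (pm_sum A B) p\<^sub>0\<^esub> (a', \<zero>\<^bsub>pm_space B p\<^sub>0\<^esub>))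
         = g p\<^sub>0 (a, \<zero>\<^bsub>pm_space B p\<^sub>0\<^esub>) \<oplus>\<^bsub>V\<^esub> g p\<^sub>0 (a', \<zero>\<^bsub>pm_space B p\<^sub>0\<^esub>)"
        if "a \<in> carrier (pm_space A p\<^sub>0)" "a' \<in> carrier (pm_space A p\<^sub>0)" for a a'
        using pm_hom_add[OF g, of "(a, \<zero>\<^bsub>pm_space B p\<^sub>0\<^esub>)" p\<^sub>0 "(a', \<zero>\<^bsub>pm_space B p\<^sub>0\<^esub>)"] that
        by (simp add: car) (simp add: filt_def)
      have 4: "g p\<^sub>0 (c \<odot>\<^bsub>pm_space (pm_sum A B) p\<^sub>0\<^esub> (a, \<zero>\<^bsub>pm_space B p\<^sub>0\<^esub>))
         = c \<odot>\<^bsub>V\<^esub> g p\<^sub>0 (a, \<zero>\<^bsub>pm_space B p\<^sub>0\<^esub>)"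
        if "c \<in> carrier K" "a \<in> carrier (pm_space A p\<^sub>0)" for c a
        using pm_hom_smult[OF g, of c "(a, \<zero>\<^bsub>pm_space B p\<^sub>0\<^esub>)" p\<^sub>0] that
        by (simp add: car) (simp add: filt_def)
      have 5: "fst (y \<oplus>\<^bsub>pm_space (pm_sum A B) p\<^sub>0\<^esub> y') = fst y \<oplus>\<^bsub>pm_space A p\<^sub>0\<^esub> fst y'"
        "fst (c \<odot>\<^bsub>pm_space (pm_sum A B) p\<^sub>0\<^esub> y) = c \<odot>\<^bsub>pm_space A p\<^sub>0\<^esub> fst y" for y y' c
        by (simp_all add: pm_sum_def direct_sum_def)
      have 6: "(a, \<zero>\<^bsub>pm_space B p\<^sub>0\<^esub>) \<oplus>\<^bsub>pm_space (pm_sum A B) p\<^sub>0\<^esub> (a', \<zero>\<^bsub>pm_space B p\<^sub>0\<^esub>)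
          = (a \<oplus>\<^bsub>pm_space A p\<^sub>0\<^esub> a', \<zero>\<^bsub>pm_space B p\<^sub>0\<^esub>)" for a a'
        by (simp add: pm_sum_def direct_sum_def)
      have 7: "c \<odot>\<^bsub>pm_space (pm_sum A B) p\<^sub>0\<^esub> (a, \<zero>\<^bsub>pm_space B p\<^sub>0\<^esub>)
          = (c \<odot>\<^bsub>pm_space A p\<^sub>0\<^esub> a, \<zero>\<^bsub>pm_space B p\<^sub>0\<^esub>)" if "c \<in> carrier K" for a c
        using that by (simp add: pm_sum_def direct_sum_def)
      show "\<pi> \<in> LinearCombinations.module_hom K V V"
        unfolding module_hom_iff
        using \<epsilon>_cl[of _ p\<^sub>0] f_cl[of _ p\<^sub>0] 1 2 3 4 top
        by (auto simp: \<pi>_def \<epsilon>_def 5 6 7)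
      show "\<pi> (\<pi> x) = \<pi> x" if "x \<in> carrier V" for x
        using f\<epsilon>[of x p\<^sub>0] that top by (simp add: \<pi>_def) (simp add: \<epsilon>_def)
      show "\<pi> x \<in> S p" if "x \<in> S p" for p x
        using \<epsilon>_cl[OF that] \<epsilon>_\<pi>[OF that] by simp
    qed
    then show ?thesis
    proof
      assume 0: "\<forall>x\<in>carrier V. \<pi> x = \<zero>\<^bsub>V\<^esub>"
      have "a = \<zero>\<^bsub>pm_space A p\<^esub>" if a: "a \<in> carrier (pm_space A p)" for a p
      proof -
        let ?x = "g p (a, \<zero>\<^bsub>pm_space B p\<^esub>)"
        have x: "?x \<in> S p" and fx: "f p ?x = (a, \<zero>\<^bsub>pm_space B p\<^esub>)"
          using pm_hom_closed[OF g, of _ p] fg[of _ p] a by (auto simp: car)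
        have "?x = \<zero>\<^bsub>V\<^esub>" using \<epsilon>_\<pi>[OF x] 0 S_carrier[OF x] fx by (simp add: \<epsilon>_def)
        then show ?thesis using fx f0[of p] by simp
      qed
      then show ?thesis using z unfolding zero_pmod_def by blast
    next
      assume 1: "\<forall>x\<in>carrier V. \<pi> x = x"
      have "b = \<zero>\<^bsub>pm_space B p\<^esub>" if b: "b \<in> carrier (pm_space B p)" for b p
      proof -
        let ?x = "g p (\<zero>\<^bsub>pm_space A p\<^esub>, b)"
        have x: "?x \<in> S p" and fx: "f p ?x = (\<zero>\<^bsub>pm_space A p\<^esub>, b)"
          using pm_hom_closed[OF g, of _ p] fg[of _ p] b by (auto simp: car)
        have "f p ?x = (\<zero>\<^bsub>pm_space A p\<^esub>, \<zero>\<^bsub>pm_space B p\<^esub>)"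
          using f\<epsilon>[OF x] \<epsilon>_\<pi>[OF x] 1 S_carrier[OF x] fx by simp
        then show ?thesis using fx by simp
      qed
      then show ?thesis using z unfolding zero_pmod_def by blast
    qed
  qed
  ultimately show ?thesis
    using persistence_module_filt unfolding indecomposable_def by blast
qed

text \<open>
  At \<open>p\<^sub>0\<close> a module \<open>M'\<close> that embeds into \<open>filt V S\<close> is isomorphic to a proper subspace \<open>W\<close> of \<open>V\<close>; a
  surjection from \<open>M'\<close> onto \<open>R\<close>, whose space at \<open>p\<^sub>0\<close> is isomorphic to \<open>V\<close>, would make \<open>W\<close> map onto \<open>V\<close>.
\<close>

lemma not_subquotient_filt:
  assumes fd: "fin_dim" and proper: "\<And>p. S p \<noteq> carrier V"
    and iso: "pm_iso K R (filt V T)" and top: "T p\<^sub>0 = carrier V"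
  shows "\<not> subquotient K R (filt V S)"
proof
  assume "subquotient K R (filt V S)"
  then obtain M' :: "('k, 'v) pmod" where M': "persistence_module K M'"
    and ne: "pm_mono K M' (filt V S) \<noteq> {}" "pm_epi K M' R \<noteq> {}"
    unfolding subquotient_def by blast
  obtain m where m: "m \<in> pm_hom K M' (filt V S)" "inj_on (m p\<^sub>0) (carrier (pm_space M' p\<^sub>0))"
    using ne(1) unfolding pm_mono_def by blast
  obtain h where h: "h \<in> pm_hom K M' R" "h p\<^sub>0 ` carrier (pm_space M' p\<^sub>0) = carrier (pm_space R p\<^sub>0)"
    using ne(2) unfolding pm_epi_def by blast
  obtain i j where i: "i \<in> pm_hom K R (filt V T)" and j: "j \<in> pm_hom K (filt V T) R"
    and ij: "\<And>y. y \<in> carrier V \<Longrightarrow> i p\<^sub>0 (j p\<^sub>0 y) = y"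
  proof -
    obtain i j where "i \<in> pm_hom K R (filt V T)" "j \<in> pm_hom K (filt V T) R"
      "\<forall>y\<in>carrier (pm_space (filt V T) p\<^sub>0). i p\<^sub>0 (j p\<^sub>0 y) = y"
      using iso unfolding pm_iso_def by blast
    then show thesis using that[of i j] top by (simp add: filt_def)
  qed
  interpret M': vectorspace K "pm_space M' p\<^sub>0"
    using M' by (rule persistence_module.vectorspace_pm_space)
  let ?C = "carrier (pm_space M' p\<^sub>0)"
  define W where "W = m p\<^sub>0 ` ?C"
  define r where "r w = inv_into ?C (m p\<^sub>0) w" for w
  have m_cl: "m p\<^sub>0 x \<in> S p\<^sub>0" if "x \<in> ?C" for x using pm_hom_closed[OF m(1) that] by simp
  have m_add: "m p\<^sub>0 (x \<oplus>\<^bsub>pm_space M' p\<^sub>0\<^esub> y) = m p\<^sub>0 x \<oplus>\<^bsub>V\<^esub> m p\<^sub>0 y" if "x \<in> ?C" "y \<in> ?C" for x y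
    using pm_hom_add[OF m(1) that] by (simp add: filt_def)
  have m_smult: "m p\<^sub>0 (c \<odot>\<^bsub>pm_space M' p\<^sub>0\<^esub> x) = c \<odot>\<^bsub>V\<^esub> m p\<^sub>0 x" if "c \<in> carrier K" "x \<in> ?C" for x c
    using pm_hom_smult[OF m(1) that] by (simp add: filt_def)
  have rm: "r (m p\<^sub>0 x) = x" if "x \<in> ?C" for x using m(2) that by (simp add: r_def)
  have m0: "m p\<^sub>0 \<zero>\<^bsub>pm_space M' p\<^sub>0\<^esub> = \<zero>\<^bsub>V\<^esub>"
    using pm_hom_zero[OF M' _ m(1), of p\<^sub>0] subspace_is_vs[OF sub] by (simp add: filt_def)
  have WS: "W \<subseteq> S p\<^sub>0" using m_cl by (auto simp: W_def)
  have W: "VectorSpace.subspace K W V"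
    unfolding subspace_iff
  proof (intro conjI ballI)
    show "W \<subseteq> carrier V" using WS S_carrier by blast
    show "\<zero>\<^bsub>V\<^esub> \<in> W" unfolding W_def m0[symmetric] by simp
    show "x \<oplus>\<^bsub>V\<^esub> y \<in> W" if "x \<in> W" "y \<in> W" for x y
      using that by (auto simp: W_def m_add[symmetric])
    show "c \<odot>\<^bsub>V\<^esub> x \<in> W" if "c \<in> carrier K" "x \<in> W" for c x
      using that by (auto simp: W_def m_smult[symmetric])
  qed
  have ih: "(\<lambda>p x. i p (h p x)) \<in> pm_hom K M' (filt V T)" by (rule pm_hom_comp[OF h(1) i])
  have "(\<lambda>w. i p\<^sub>0 (h p\<^sub>0 (r w))) \<in> LinearCombinations.module_hom K (V\<lparr>carrier := W\<rparr>) V"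
    unfolding module_hom_iff
  proof (intro conjI ballI Pi_I; simp)
    show "i p\<^sub>0 (h p\<^sub>0 (r w)) \<in> carrier V" if "w \<in> W" for w
      using that pm_hom_closed[OF ih, of _ p\<^sub>0] top by (auto simp: W_def rm filt_def)
    show "i p\<^sub>0 (h p\<^sub>0 (r (w \<oplus>\<^bsub>V\<^esub> w'))) = i p\<^sub>0 (h p\<^sub>0 (r w)) \<oplus>\<^bsub>V\<^esub> i p\<^sub>0 (h p\<^sub>0 (r w'))"
      if "w \<in> W" "w' \<in> W" for w w'
      using that pm_hom_add[OF ih, of _ p\<^sub>0] by (auto simp: W_def rm filt_def m_add[symmetric])
    show "i p\<^sub>0 (h p\<^sub>0 (r (c \<odot>\<^bsub>V\<^esub> w))) = c \<odot>\<^bsub>V\<^esub> i p\<^sub>0 (h p\<^sub>0 (r w))"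
      if "c \<in> carrier K" "w \<in> W" for c w
      using that pm_hom_smult[OF ih, of _ _ p\<^sub>0] by (auto simp: W_def rm filt_def m_smult[symmetric])
  qed
  moreover have "(\<lambda>w. i p\<^sub>0 (h p\<^sub>0 (r w))) ` W = carrier V"
  proof (intro equalityI subsetI)
    fix y assume "y \<in> (\<lambda>w. i p\<^sub>0 (h p\<^sub>0 (r w))) ` W"
    then show "y \<in> carrier V"
      using pm_hom_closed[OF ih, of _ p\<^sub>0] top by (auto simp: W_def rm filt_def)
  next
    fix y assume y: "y \<in> carrier V"
    then have "j p\<^sub>0 y \<in> carrier (pm_space R p\<^sub>0)"
      using pm_hom_closed[OF j, of y p\<^sub>0] top by (simp add: filt_def)
    then obtain x where "x \<in> ?C" "h p\<^sub>0 x = j p\<^sub>0 y" using h(2) by (metis imageE)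
    then have "m p\<^sub>0 x \<in> W" "i p\<^sub>0 (h p\<^sub>0 (r (m p\<^sub>0 x))) = y" using ij[OF y] by (auto simp: W_def rm)
    then show "y \<in> (\<lambda>w. i p\<^sub>0 (h p\<^sub>0 (r w))) ` W" by (metis imageI)
  qed
  moreover have "W \<noteq> carrier V" using WS proper[of p\<^sub>0] sub[of p\<^sub>0] by (auto simp: subspace_iff)
  ultimately show False using no_surj_from_proper_subspace[OF fd W] by blast
qed

end

section \<open>The operator and its frame of invariant subspaces\<close>

lemma all_less6: "(\<forall>i<6. P i) \<longleftrightarrow> P 0 \<and> P 1 \<and> P 2 \<and> P 3 \<and> P 4 \<and> P (5 :: nat)"
  by (simp add: eval_nat_numeral All_less_Suc conj_ac)

locale chain_space = coord_space K "2 * n" for K :: "('k, 'm) ring_scheme" (structure) and n :: nat +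
  assumes n2: "n \<ge> 2"
begin

definition d :: nat where "d = 2 * n - 1"

lemma less_2n [simp]: "k < 2 * n \<longleftrightarrow> k < d \<or> k = d"
  and d_gt [simp]: "2 < d" "0 < d" "d \<noteq> 0" "Suc 0 < d" "0 \<noteq> d" "\<not> d < 2" "d - Suc 0 < d" "d \<noteq> d - Suc 0"
  and odd_d [simp]: "odd d" "even (d - Suc 0)"
  and d_minus: "d - 1 = 2 * (n - 1)"
  unfolding d_def using n2 by presburger+

lemma diff_less_d [simp]: "k < d \<Longrightarrow> k - j < d"
  by simp

definition vec :: "(nat \<Rightarrow> 'k) \<Rightarrow> nat \<Rightarrow> 'k" where "vec x = (\<lambda>k\<in>{..<2 * n}. x k)"

lemma coord_vec [simp]: "k < 2 * n \<Longrightarrow> vec x k = x k"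
  by (simp add: vec_def)

lemma vec_closed [simp]: "vec x \<in> carrier V \<longleftrightarrow> (\<forall>k<2 * n. x k \<in> carrier K)"
  by (simp add: carrier_V vec_def del: less_2n)

text \<open>
  On unit vectors: \<open>e\<^sub>k \<mapsto> e\<^sub>k\<^sub>+\<^sub>2\<close> for \<open>k + 2 < d\<close>; the end \<open>e\<^sub>d\<^sub>-\<^sub>1\<close> of the chain of even indices goes
  to \<open>e\<^sub>d\<close>, which is fixed; and the end \<open>e\<^sub>d\<^sub>-\<^sub>2\<close> of the chain of odd indices goes to \<open>0\<close>. The
  coordinate \<open>d\<close>, although odd, belongs to neither chain.
\<close>

definition f :: "(nat \<Rightarrow> 'k) \<Rightarrow> nat \<Rightarrow> 'k" where
  "f x = vec (\<lambda>k. if k < 2 then \<zero> else if k < d then x (k - 2) else x (d - 1) \<oplus> x d)"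

lemma coord_f: "k < d \<Longrightarrow> f x k = (if k < 2 then \<zero> else x (k - 2))"
  "f x d = x (d - 1) \<oplus> x d"
  by (simp_all add: f_def)

lemma f_closed [simp]: "x \<in> carrier V \<Longrightarrow> f x \<in> carrier V"
  by (auto simp: f_def)

lemma f_add: "x \<in> carrier V \<Longrightarrow> y \<in> carrier V \<Longrightarrow> f (x \<oplus>\<^bsub>V\<^esub> y) = f x \<oplus>\<^bsub>V\<^esub> f y"
  by (intro V_eqI) (auto simp: coord_f a_ac)

lemma f_smult: "c \<in> carrier K \<Longrightarrow> x \<in> carrier V \<Longrightarrow> f (c \<odot>\<^bsub>V\<^esub> x) = c \<odot>\<^bsub>V\<^esub> f x"
  by (intro V_eqI) (auto simp: coord_f r_distr)

lemma f_hom: "f \<in> LinearCombinations.module_hom K V V"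
  by (simp add: module_hom_iff f_add f_smult)

text \<open>
  Modulo \<open>lastline\<close>, the subspaces \<open>graph0\<close> and \<open>graph1\<close> are the graphs of the maps \<open>e\<^sub>k \<mapsto> e\<^sub>k\<^sub>+\<^sub>1\<close> from
  \<open>evens\<close> to \<open>odds\<close> and from \<open>odds\<close> to \<open>evens\<close>, with \<open>e\<^sub>d\<^sub>-\<^sub>1 \<mapsto> 0\<close>. A linear map that preserves the two
  summands and both graphs commutes with both maps, hence with the shift of length \<open>d\<close> that they form
  together. As \<open>f\<close> agrees with the square of this shift only modulo \<open>lastline\<close>, the four subspaces are taken to
  contain \<open>lastline\<close>, so that \<open>f\<close> preserves them.
\<close>

definition lastline where "lastline = {x \<in> carrier V. \<forall>k<d. x k = \<zero>}"
definition evens where "evens = {x \<in> carrier V. \<forall>k<d. odd k \<longrightarrow> x k = \<zero>}"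
definition odds where "odds = {x \<in> carrier V. \<forall>k<d. even k \<longrightarrow> x k = \<zero>}"
definition graph0 where "graph0 = {x \<in> carrier V. \<forall>k. even k \<and> Suc k < d \<longrightarrow> x k = x (Suc k)}"
definition graph1 where
  "graph1 = {x \<in> carrier V. x 0 = \<zero> \<and> (\<forall>k. odd k \<and> Suc k < d \<longrightarrow> x k = x (Suc k))}"
definition im_one_minus_f where "im_one_minus_f = (\<lambda>x. x \<ominus>\<^bsub>V\<^esub> f x) ` carrier V"

lemmas frame_part_defs = lastline_def evens_def odds_def graph0_def graph1_def

text \<open>
  The list form allows one statement about all six subspaces at once and one corner of the plane for each.
\<close>

definition frame :: "nat \<Rightarrow> (nat \<Rightarrow> 'k) set" where
  "frame i = [lastline, evens, odds, graph0, graph1, im_one_minus_f] ! i"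

lemma im_one_minus_f_subspace: "VectorSpace.subspace K im_one_minus_f V"
  unfolding V.subspace_iff
proof (intro conjI ballI)
  show "im_one_minus_f \<subseteq> carrier V" by (auto simp: im_one_minus_f_def)
  have "\<zero>\<^bsub>V\<^esub> = \<zero>\<^bsub>V\<^esub> \<ominus>\<^bsub>V\<^esub> f \<zero>\<^bsub>V\<^esub>"
    by (intro V_eqI) (auto simp: coord_f a_minus_def)
  then show "\<zero>\<^bsub>V\<^esub> \<in> im_one_minus_f" by (auto simp: im_one_minus_f_def)
  show "x \<oplus>\<^bsub>V\<^esub> y \<in> im_one_minus_f" if xy: "x \<in> im_one_minus_f" "y \<in> im_one_minus_f" for x y
  proof -
    obtain u v where uv: "u \<in> carrier V" "v \<in> carrier V" "x = u \<ominus>\<^bsub>V\<^esub> f u" "y = v \<ominus>\<^bsub>V\<^esub> f v"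
      using xy by (auto simp: im_one_minus_f_def)
    then have "x \<oplus>\<^bsub>V\<^esub> y = (u \<oplus>\<^bsub>V\<^esub> v) \<ominus>\<^bsub>V\<^esub> f (u \<oplus>\<^bsub>V\<^esub> v)"
      by (simp add: f_add V.minus_eq V.minus_add V.a_ac)
    then show ?thesis using uv by (auto simp: im_one_minus_f_def)
  qed
  show "c \<odot>\<^bsub>V\<^esub> x \<in> im_one_minus_f" if cx: "c \<in> carrier K" "x \<in> im_one_minus_f" for c x
  proof -
    obtain u where u: "u \<in> carrier V" "x = u \<ominus>\<^bsub>V\<^esub> f u" using cx by (auto simp: im_one_minus_f_def)
    then have "c \<odot>\<^bsub>V\<^esub> x = (c \<odot>\<^bsub>V\<^esub> u) \<ominus>\<^bsub>V\<^esub> f (c \<odot>\<^bsub>V\<^esub> u)"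
      using that by (simp add: f_smult V.minus_eq V.smult_r_distr V.smult_r_minus)
    then show ?thesis using u that by (auto simp: im_one_minus_f_def)
  qed
qed

lemma frame_subspace: "\<forall>i<6. VectorSpace.subspace K (frame i) V"
  using im_one_minus_f_subspace unfolding all_less6 frame_def V.subspace_iff
  by (simp add: frame_part_defs)

lemma frame_stable: "\<forall>i<6. \<forall>x\<in>frame i. f x \<in> frame i"
proof -
  have "f x \<in> lastline" if "x \<in> lastline" for x
    using that by (auto simp: lastline_def coord_f)
  moreover have "f x \<in> evens" if "x \<in> evens" for x
    using that by (auto simp: evens_def coord_f)
  moreover have "f x \<in> odds" if "x \<in> odds" for x
    using that by (auto simp: odds_def coord_f)
  moreover have "f x \<in> graph0" if "x \<in> graph0" for x
  proof -
    have "f x k = f x (Suc k)" if "even k" "Suc k < d" for k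
    proof (cases "k < 2")
      case True
      then show ?thesis using that \<open>x \<in> graph0\<close> by (auto simp: graph0_def coord_f less_2_cases_iff)
    next
      case False
      then obtain j where j: "k = Suc (Suc j)" by (metis add_2_eq_Suc le_Suc_ex not_less)
      then have "x j = x (Suc j)" using that \<open>x \<in> graph0\<close> by (auto simp: graph0_def)
      then show ?thesis using that j by (simp add: coord_f)
    qed
    then show ?thesis using that by (simp add: graph0_def)
  qed
  moreover have "f x \<in> graph1" if "x \<in> graph1" for x
  proof -
    have "f x k = f x (Suc k)" if "odd k" "Suc k < d" for k
    proof (cases "k < 2")
      case True
      then show ?thesis using that \<open>x \<in> graph1\<close> by (auto simp: graph1_def coord_f less_2_cases_iff)
    next
      case False
      then obtain j where j: "k = Suc (Suc j)" by (metis add_2_eq_Suc le_Suc_ex not_less)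
      then have "x j = x (Suc j)" using that \<open>x \<in> graph1\<close> by (auto simp: graph1_def)
      then show ?thesis using that j by (simp add: coord_f)
    qed
    then show ?thesis using that n2 by (simp add: graph1_def coord_f)
  qed
  moreover have "f x \<in> im_one_minus_f" if x: "x \<in> im_one_minus_f" for x
  proof -
    obtain u where u: "u \<in> carrier V" "x = u \<ominus>\<^bsub>V\<^esub> f u" using x by (auto simp: im_one_minus_f_def)
    interpret f: mod_hom K V V f by unfold_locales (rule f_hom)
    have "f x = f u \<ominus>\<^bsub>V\<^esub> f (f u)" using u by simp
    then show ?thesis using u by (auto simp: im_one_minus_f_def)
  qed
  ultimately show ?thesis unfolding all_less6 frame_def by simp
qed

text \<open>
  The shift \<open>e\<^sub>k \<mapsto> e\<^sub>k\<^sub>+\<^sub>1\<close> on the first \<open>d\<close> coordinates and its adjoint.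
\<close>

definition up :: "(nat \<Rightarrow> 'k) \<Rightarrow> nat \<Rightarrow> 'k" where
  "up x = vec (\<lambda>k. if 0 < k \<and> k < d then x (k - 1) else \<zero>)"

definition down :: "(nat \<Rightarrow> 'k) \<Rightarrow> nat \<Rightarrow> 'k" where
  "down x = vec (\<lambda>k. if Suc k < d then x (Suc k) else \<zero>)"

lemma up_closed [simp]: "x \<in> carrier V \<Longrightarrow> up x \<in> carrier V"
  and down_closed [simp]: "x \<in> carrier V \<Longrightarrow> down x \<in> carrier V"
  by (auto simp: up_def down_def)

lemma coord_up [simp]: "k < 2 * n \<Longrightarrow> up x k = (if 0 < k \<and> k < d then x (k - 1) else \<zero>)"
  and coord_down [simp]: "k < 2 * n \<Longrightarrow> down x k = (if Suc k < d then x (Suc k) else \<zero>)"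
  by (simp_all add: up_def down_def)

text \<open>
  If \<open>z - f z\<close> lies in \<open>lastline\<close>, then so does \<open>z\<close>, since \<open>f\<close> is nilpotent modulo \<open>lastline\<close>; but \<open>f\<close>
  fixes \<open>lastline\<close> pointwise.
\<close>

lemma im_one_minus_f_inter_lastline: "x \<in> im_one_minus_f \<Longrightarrow> x \<in> lastline \<Longrightarrow> x = \<zero>\<^bsub>V\<^esub>"
proof -
  assume "x \<in> im_one_minus_f" and l: "x \<in> lastline"
  then obtain z where z: "z \<in> carrier V" "x = z \<ominus>\<^bsub>V\<^esub> f z" by (auto simp: im_one_minus_f_def)
  have zf: "z k = f z k" if "k < d" for k
  proof -
    have "z k \<ominus> f z k = \<zero>" using l that z by (auto simp: lastline_def)
    then show ?thesis using that z by simp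
  qed
  have 0: "z k = \<zero>" if "k < d" for k
    using that
  proof (induction k rule: less_induct)
    case (less k)
    then show ?case using zf[of k] by (auto simp: coord_f split: if_splits)
  qed
  show ?thesis
    using z 0 by (intro V_eqI) (auto simp: coord_f r_neg a_minus_def)
qed

end

section \<open>Rigidity of the frame\<close>

text \<open>
  The condition on the last coordinate of \<open>\<pi> e\<^sub>0\<close> excludes the spectral projection of \<open>f\<close> to the
  eigenvalue \<open>1\<close>, which satisfies all others: it sends \<open>e\<^sub>0\<close> to \<open>e\<^sub>d\<close>.
\<close>

locale frame_projection = chain_space K n for K :: "('k, 'm) ring_scheme" (structure) and n +
  fixes \<pi> :: "(nat \<Rightarrow> 'k) \<Rightarrow> nat \<Rightarrow> 'k"
  assumes hom: "\<pi> \<in> LinearCombinations.module_hom K V V"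
    and idem: "x \<in> carrier V \<Longrightarrow> \<pi> (\<pi> x) = \<pi> x"
    and frame_inv: "i < 6 \<Longrightarrow> x \<in> frame i \<Longrightarrow> \<pi> x \<in> frame i"
    and e0: "\<pi> (e 0) d = \<zero>"
begin

sublocale p: mod_hom K V V \<pi> by unfold_locales (rule hom)

lemma pi_closed [simp]: "x \<in> carrier V \<Longrightarrow> \<pi> x \<in> carrier V"
  by (rule p.f_im)

lemma pi_frame: "x \<in> lastline \<Longrightarrow> \<pi> x \<in> lastline" "x \<in> evens \<Longrightarrow> \<pi> x \<in> evens" "x \<in> odds \<Longrightarrow> \<pi> x \<in> odds"
  "x \<in> graph0 \<Longrightarrow> \<pi> x \<in> graph0" "x \<in> graph1 \<Longrightarrow> \<pi> x \<in> graph1" "x \<in> im_one_minus_f \<Longrightarrow> \<pi> x \<in> im_one_minus_f"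
  using frame_inv[of 0 x] frame_inv[of 1 x] frame_inv[of 2 x]
    frame_inv[of 3 x] frame_inv[of 4 x] frame_inv[of 5 x] by (simp_all add: frame_def)

text \<open>
  Modulo \<open>lastline\<close>, \<open>\<pi>\<close> commutes with \<open>up\<close>. For \<open>y\<close> in \<open>evens\<close>, the vector \<open>y + up y\<close> lies in \<open>graph0\<close>, and so
  does its image \<open>\<pi> y + \<pi> (up y)\<close>, whose summands lie in \<open>evens\<close> and \<open>odds\<close>; membership in \<open>graph0\<close> then
  says that the odd part is the shift of the even part. The case of \<open>odds\<close> and \<open>graph1\<close> is analogous, and
  every vector is a sum of the two kinds.
\<close>

lemma pi_up:
  assumes x: "x \<in> carrier V" and k: "k < d"
  shows "\<pi> (up x) k = up (\<pi> x) k"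
proof -
  have E: "\<pi> (up y) k = up (\<pi> y) k" if y: "y \<in> evens" for y
  proof -
    have yV: "y \<in> carrier V" and y0: "\<And>k. k < d \<Longrightarrow> odd k \<Longrightarrow> y k = \<zero>" using y by (auto simp: evens_def)
    have uo: "up y \<in> odds" using yV y0 by (auto simp: odds_def)
    have g: "y \<oplus>\<^bsub>V\<^esub> up y \<in> graph0"
    proof -
      have "(y \<oplus>\<^bsub>V\<^esub> up y) k = (y \<oplus>\<^bsub>V\<^esub> up y) (Suc k)" if "even k" "Suc k < d" for k
        using that yV y0[of "Suc k"] y0[of "k - 1"] by (cases k) auto
      then show ?thesis using yV by (simp add: graph0_def)
    qed
    have e: "\<pi> y \<in> evens" and o: "\<pi> (up y) \<in> odds" using pi_frame y uo by auto
    have "\<pi> (y \<oplus>\<^bsub>V\<^esub> up y) \<in> graph0" using pi_frame g by blast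
    then have g': "\<pi> y \<oplus>\<^bsub>V\<^esub> \<pi> (up y) \<in> graph0" using yV by simp
    show ?thesis
    proof (cases "even k")
      case True
      then show ?thesis using o e k by (cases k) (auto simp: odds_def evens_def)
    next
      case False
      then obtain j where j: "k = Suc j" "even j" by (cases k) auto
      have "(\<pi> y \<oplus>\<^bsub>V\<^esub> \<pi> (up y)) j = (\<pi> y \<oplus>\<^bsub>V\<^esub> \<pi> (up y)) (Suc j)"
        using g' j k by (auto simp: graph0_def)
      moreover have "\<pi> y (Suc j) = \<zero>" "\<pi> (up y) j = \<zero>" using e o j k by (auto simp: evens_def odds_def)
      ultimately show ?thesis using j k yV by simp
    qed
  qed
  have O: "\<pi> (up y) k = up (\<pi> y) k" if y: "y \<in> odds" for y
  proof -
    have yV: "y \<in> carrier V" and y0: "\<And>k. k < d \<Longrightarrow> even k \<Longrightarrow> y k = \<zero>" using y by (auto simp: odds_def)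
    have ue: "up y \<in> evens" using yV y0 by (auto simp: evens_def)
    have g: "y \<oplus>\<^bsub>V\<^esub> up y \<in> graph1"
    proof -
      have "(y \<oplus>\<^bsub>V\<^esub> up y) k = (y \<oplus>\<^bsub>V\<^esub> up y) (Suc k)" if "odd k" "Suc k < d" for k
        using that yV y0[of "Suc k"] y0[of "k - 1"] by (cases k) auto
      then show ?thesis using yV y0[of 0] n2 by (simp add: graph1_def)
    qed
    have o: "\<pi> y \<in> odds" and e: "\<pi> (up y) \<in> evens" using pi_frame y ue by auto
    have "\<pi> (y \<oplus>\<^bsub>V\<^esub> up y) \<in> graph1" using pi_frame g by blast
    then have g': "\<pi> y \<oplus>\<^bsub>V\<^esub> \<pi> (up y) \<in> graph1" using yV by simp
    show ?thesis
    proof (cases "odd k")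
      case True
      then show ?thesis using o e k by (cases k) (auto simp: odds_def evens_def)
    next
      case False
      show ?thesis
      proof (cases k)
        case 0
        have "(\<pi> y \<oplus>\<^bsub>V\<^esub> \<pi> (up y)) 0 = \<zero>" using g' by (auto simp: graph1_def)
        moreover have "\<pi> y 0 = \<zero>" using o by (auto simp: odds_def)
        ultimately show ?thesis using 0 yV n2 by simp
      next
        case (Suc j)
        then have j: "k = Suc j" "odd j" using False by auto
        have "(\<pi> y \<oplus>\<^bsub>V\<^esub> \<pi> (up y)) j = (\<pi> y \<oplus>\<^bsub>V\<^esub> \<pi> (up y)) (Suc j)"
          using g' j k by (auto simp: graph1_def)
        moreover have "\<pi> y (Suc j) = \<zero>" "\<pi> (up y) j = \<zero>" using e o j k by (auto simp: evens_def odds_def)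
        ultimately show ?thesis using j k yV by simp
      qed
    qed
  qed
  define y where "y = vec (\<lambda>k. if k < d \<and> odd k then \<zero> else x k)"
  define z where "z = vec (\<lambda>k. if k < d \<and> odd k then x k else \<zero>)"
  have y: "y \<in> evens" and z: "z \<in> odds" using x by (auto simp: y_def z_def evens_def odds_def)
  then have yz: "y \<in> carrier V" "z \<in> carrier V" by (auto simp: evens_def odds_def)
  have xyz: "x = y \<oplus>\<^bsub>V\<^esub> z" using x yz by (intro V_eqI) (auto simp: y_def z_def)
  have "up x = up y \<oplus>\<^bsub>V\<^esub> up z" unfolding xyz using yz by (intro V_eqI) auto
  then have "\<pi> (up x) k = up (\<pi> y) k \<oplus> up (\<pi> z) k" using E[OF y] O[OF z] yz k by simp
  also have "\<dots> = up (\<pi> x) k" unfolding xyz using yz k by simp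
  finally show ?thesis .
qed

lemma pi_expand:
  assumes y: "y \<in> carrier V" and k: "k < d"
  shows "\<pi> y k = y 0 \<otimes> \<pi> (e 0) k \<oplus> up (\<pi> (down y)) k"
proof -
  have eq: "y = (y 0 \<odot>\<^bsub>V\<^esub> e 0 \<oplus>\<^bsub>V\<^esub> up (down y)) \<oplus>\<^bsub>V\<^esub> y d \<odot>\<^bsub>V\<^esub> e d"
    using y n2 by (intro V_eqI) auto
  have "y d \<odot>\<^bsub>V\<^esub> e d \<in> lastline" using y by (auto simp: lastline_def)
  then have "\<pi> (y d \<odot>\<^bsub>V\<^esub> e d) k = \<zero>" using pi_frame(1) k by (auto simp: lastline_def)
  then have "\<pi> ((y 0 \<odot>\<^bsub>V\<^esub> e 0 \<oplus>\<^bsub>V\<^esub> up (down y)) \<oplus>\<^bsub>V\<^esub> y d \<odot>\<^bsub>V\<^esub> e d) k =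
      y 0 \<otimes> \<pi> (e 0) k \<oplus> \<pi> (up (down y)) k"
    using y k n2 by simp
  then show ?thesis using eq pi_up[of "down y" k] y k by simp
qed

text \<open>
  Commuting with the shift modulo \<open>lastline\<close> makes \<open>\<pi>\<close> lower triangular in the first \<open>d\<close> coordinates, with all
  diagonal entries equal.
\<close>

lemma pi_diag:
  assumes "y \<in> carrier V" "k < d" "\<And>j. j < k \<Longrightarrow> y j = \<zero>"
  shows "\<pi> y k = \<pi> (e 0) 0 \<otimes> y k"
  using assms
proof (induction k arbitrary: y)
  case 0
  then show ?case using pi_expand[of y 0] n2 by (simp add: m_comm)
next
  case (Suc k)
  have "\<pi> (down y) k = \<pi> (e 0) 0 \<otimes> down y k"
    using Suc by (intro Suc.IH) auto
  then show ?case using pi_expand[of y "Suc k"] Suc.prems n2 by simp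
qed

lemma diag_idem: "\<pi> (e 0) 0 = \<zero> \<or> \<pi> (e 0) 0 = \<one>"
proof -
  have "\<pi> (e 0) 0 = \<pi> (e 0) 0 \<otimes> \<pi> (e 0) 0"
    using pi_diag[of "\<pi> (e 0)" 0] idem[of "e 0"] by simp
  moreover have "\<pi> (e 0) 0 \<in> carrier K" by simp
  ultimately show ?thesis using m_lcancel[of "\<pi> (e 0) 0" "\<pi> (e 0) 0" \<one>] by auto
qed

text \<open>
  If the diagonal vanishes, the idempotent \<open>\<pi>\<close> is nilpotent modulo \<open>lastline\<close>, hence maps everything into
  \<open>lastline\<close>. Then \<open>\<pi>\<close> kills \<open>(1 - f) V\<close>, so \<open>\<pi> = \<pi> f\<close>. Applied along the orbit of \<open>e\<^sub>0\<close> this gives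
  \<open>\<pi> e\<^sub>d = \<pi> e\<^sub>0 = 0\<close>, and as the \<open>n\<close>-th power of \<open>f\<close> maps \<open>V\<close> into the line of \<open>e\<^sub>d\<close>, \<open>\<pi> = 0\<close>.
\<close>

lemma pi_zero:
  assumes r: "\<pi> (e 0) 0 = \<zero>" and x: "x \<in> carrier V"
  shows "\<pi> x = \<zero>\<^bsub>V\<^esub>"
proof -
  have last: "\<pi> x \<in> lastline" if x: "x \<in> carrier V" for x
  proof -
    \<comment> \<open>The first nonzero coordinate of the fixed vector \<open>\<pi> x\<close> would be multiplied by the diagonal entry \<open>0\<close>.\<close>
    have "\<pi> x k = \<zero>" if "k < d" for k
      using that
    proof (induction k rule: less_induct)
      case (less k)
      then show ?case
        using pi_diag[of "\<pi> x" k] idem[OF x] x r by simp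
    qed
    then show ?thesis using x by (simp add: lastline_def)
  qed
  have pf: "\<pi> (f x) = \<pi> x" if x: "x \<in> carrier V" for x
  proof -
    have "\<pi> (x \<ominus>\<^bsub>V\<^esub> f x) = \<zero>\<^bsub>V\<^esub>"
      using x by (intro im_one_minus_f_inter_lastline pi_frame last) (auto simp: im_one_minus_f_def)
    then have "\<pi> x \<ominus>\<^bsub>V\<^esub> \<pi> (f x) = \<zero>\<^bsub>V\<^esub>" using x by simp
    then show ?thesis using x by (metis V.minus_other_side f_closed pi_closed)
  qed
  have pe0: "\<pi> (e 0) = \<zero>\<^bsub>V\<^esub>"
    using last[of "e 0"] e0 by (intro V_eqI) (auto simp: lastline_def)
  have fe: "f (e k) = e (k + 2)" if "k + 2 < d" for k
    using that n2 by (intro V_eqI) (auto simp: coord_f)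
  have fe': "f (e (d - 1)) = e d"
    by (intro V_eqI) (auto simp: coord_f)
  have "\<pi> (e (2 * m)) = \<zero>\<^bsub>V\<^esub>" if "m < n" for m
    using that
  proof (induction m)
    case (Suc m)
    then have "2 * m + 2 < d" by (simp add: d_def)
    then show ?case using Suc fe[of "2 * m"] pf[of "e (2 * m)"] by simp
  qed (simp add: pe0)
  from this[of "n - 1"] have "\<pi> (e d) = \<zero>\<^bsub>V\<^esub>"
    using fe' pf[of "e (d - 1)"] n2 unfolding d_minus by simp
  then have line: "\<pi> y = \<zero>\<^bsub>V\<^esub>" if "y \<in> lastline" for y
  proof -
    have y: "y \<in> carrier V" using that by (simp add: lastline_def)
    have "y d \<odot>\<^bsub>V\<^esub> e d = y" using that y by (intro V_eqI) (auto simp: lastline_def)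
    moreover have "\<pi> (y d \<odot>\<^bsub>V\<^esub> e d) = \<zero>\<^bsub>V\<^esub>" using \<open>\<pi> (e d) = \<zero>\<^bsub>V\<^esub>\<close> y by simp
    ultimately show ?thesis by simp
  qed
  have fm: "(f ^^ m) x \<in> carrier V \<and> \<pi> ((f ^^ m) x) = \<pi> x \<and> (\<forall>k<d. k < 2 * m \<longrightarrow> (f ^^ m) x k = \<zero>)" for m
  proof (induction m)
    case (Suc m)
    then show ?case by (auto simp: pf coord_f)
  qed (simp add: x)
  have "(f ^^ n) x \<in> lastline" using fm[of n] by (auto simp: lastline_def)
  then show ?thesis using fm[of n] line by metis
qed

end

context chain_space
begin

lemma frame_projection_trivial:
  assumes "frame_projection K n \<pi>"
  shows "(\<forall>x\<in>carrier V. \<pi> x = \<zero>\<^bsub>V\<^esub>) \<or> (\<forall>x\<in>carrier V. \<pi> x = x)"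
proof -
  interpret frame_projection K n \<pi> by fact
  consider "\<pi> (e 0) 0 = \<zero>" | "\<pi> (e 0) 0 = \<one>" using diag_idem by blast
  then show ?thesis
  proof cases
    case 1
    then show ?thesis using pi_zero by blast
  next
    case 2
    \<comment> \<open>The complementary idempotent has diagonal entry \<open>0\<close>.\<close>
    interpret c: frame_projection K n "\<lambda>x. x \<ominus>\<^bsub>V\<^esub> \<pi> x"
    proof
      show "(\<lambda>x. x \<ominus>\<^bsub>V\<^esub> \<pi> x) \<in> LinearCombinations.module_hom K V V"
        unfolding module_hom_iff
        by (auto simp: V.minus_eq V.minus_add V.a_ac V.smult_r_distr V.smult_r_minus)
      show "x \<ominus>\<^bsub>V\<^esub> \<pi> x \<ominus>\<^bsub>V\<^esub> \<pi> (x \<ominus>\<^bsub>V\<^esub> \<pi> x) = x \<ominus>\<^bsub>V\<^esub> \<pi> x" if "x \<in> carrier V" for x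
        using that idem by (simp add: V.minus_eq V.r_neg)
      show "x \<ominus>\<^bsub>V\<^esub> \<pi> x \<in> frame i" if "i < 6" "x \<in> frame i" for i x
        using that frame_inv frame_subspace by (intro V.subspace_minus) auto
      show "(e 0 \<ominus>\<^bsub>V\<^esub> \<pi> (e 0)) d = \<zero>" using e0 n2 by (simp add: a_minus_def)
    qed
    have "(e 0 \<ominus>\<^bsub>V\<^esub> \<pi> (e 0)) 0 = \<zero>" using 2 n2 by (simp add: a_minus_def r_neg)
    then have "x \<ominus>\<^bsub>V\<^esub> \<pi> x = \<zero>\<^bsub>V\<^esub>" if "x \<in> carrier V" for x using c.pi_zero that by simp
    then show ?thesis by (metis V.minus_other_side pi_closed)
  qed
qed

end

section \<open>The filtration and its erosions\<close>

lemma (in filtration) shift_Int: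
  assumes "VectorSpace.subspace K A V" "a \<ge> 0"
  shows "filtration K V (\<lambda>p. S (p + (a, a)) \<inter> A)"
proof (intro filtration.intro filtration_axioms.intro)
  show "VectorSpace.subspace K (S (p + (a, a)) \<inter> A) V" for p
    by (intro subspace_Int sub assms)
  show "S (p + (a, a)) \<inter> A \<subseteq> S (q + (a, a)) \<inter> A" if "p \<le> q" for p q
    using incr[of "p + (a, a)" "q + (a, a)"] that by (auto simp: less_eq_prod_def)
qed (fact vectorspace_axioms)

context chain_space
begin

text \<open>
  Points on the antidiagonal, spaced so widely that one of them, moved down the diagonal by less than
  \<open>n\<close>, is still incomparable to the others and has first coordinate at least \<open>2 n\<close>.
\<close>

definition corner :: "nat \<Rightarrow> real \<times> real" where
  "corner i = (real (4 * n * Suc i), - real (4 * n * Suc i))"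

text \<open>
  Imposing the conditions on downward closed regions and intersecting them makes the spaces increase with
  \<open>p\<close> and keeps them subspaces. Along the diagonal the first condition lets coordinate \<open>k\<close> appear at
  \<open>(k, k)\<close>; as \<open>f\<close> raises indices by at most two, it respects this up to a shift by \<open>2\<close>. Just
  below \<open>corner i\<close>, the only remaining condition is membership in \<open>frame i\<close>.
\<close>

definition M :: "real \<times> real \<Rightarrow> (nat \<Rightarrow> 'k) set" where
  "M p = {x \<in> carrier V. (\<forall>k<2 * n. fst p < real k \<and> snd p < real k \<longrightarrow> x k = \<zero>) \<and>
     (\<forall>i<6. p \<le> corner i \<longrightarrow> x \<in> frame i)}"

lemma M_filtration: "filtration K V M"
proof (intro filtration.intro filtration_axioms.intro)
  show "VectorSpace.subspace K (M p) V" for p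
    using frame_subspace unfolding V.subspace_iff M_def by auto
  show "M p \<subseteq> M q" if "p \<le> q" for p q
  proof
    fix x assume x: "x \<in> M p"
    have "x k = \<zero>" if "k < 2 * n" "fst q < real k" "snd q < real k" for k
      using x that \<open>p \<le> q\<close> by (auto simp: M_def less_eq_prod_def simp del: less_2n)
    moreover have "x \<in> frame i" if "i < 6" "q \<le> corner i" for i
      using x that \<open>p \<le> q\<close> order_trans[of p q "corner i"] unfolding M_def by blast
    ultimately show "x \<in> M q" using x unfolding M_def by blast
  qed
qed (rule V.vectorspace_axioms)

sublocale M: filtration K V M by (rule M_filtration)

lemma f_M: assumes x: "x \<in> M p" shows "f x \<in> M (p + (2, 2))"
proof -
  have xV: "x \<in> carrier V" using x by (simp add: M_def)
  have z: "x k = \<zero>" if "k < 2 * n" "fst p < real k" "snd p < real k" for k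
    using x that unfolding M_def by blast
  have "f x k = \<zero>" if k: "k < 2 * n" "fst (p + (2, 2)) < real k" "snd (p + (2, 2)) < real k" for k
  \<comment> \<open>The coordinates \<open>d - 1\<close> and \<open>d\<close> feed into coordinate \<open>d\<close>, which raises their index by at most one.\<close>
  proof (cases "k = d")
    case True
    have "fst p < real (d - 1)" "snd p < real (d - 1)" "fst p < real d" "snd p < real d"
      using k True by (simp_all add: of_nat_diff)
    then show ?thesis using True z[of "d - 1"] z[of d] by (simp add: coord_f)
  next
    case False
    then show ?thesis using k z[of "k - 2"] by (auto simp: coord_f of_nat_diff)
  qed
  moreover have "f x \<in> frame i" if "i < 6" "p + (2, 2) \<le> corner i" for i
  proof -
    have "p \<le> p + (2, 2)" by (simp add: less_eq_prod_def)
    then have "x \<in> frame i" using x that order_trans[of p "p + (2, 2)" "corner i"] unfolding M_def by blast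
    then show ?thesis using frame_stable that by blast
  qed
  moreover have "f x \<in> carrier V" using xV by simp
  ultimately show ?thesis unfolding M_def by blast
qed

definition far :: "real \<times> real" where "far = (real (40 * n), real (40 * n))"

lemma M_eventually_V: "real (24 * n) < fst p \<Longrightarrow> real (2 * n) \<le> snd p \<Longrightarrow> M p = carrier V"
proof -
  assume p: "real (24 * n) < fst p" "real (2 * n) \<le> snd p"
  have "\<not> p \<le> corner i" if "i < 6" for i
  proof
    assume "p \<le> corner i"
    then have "fst p \<le> real (4 * n * Suc i)" by (simp add: corner_def less_eq_prod_def)
    also have "\<dots> \<le> real (4 * n * 6)" using that by (intro of_nat_mono mult_le_mono2) simp
    finally show False using p by simp
  qed
  moreover have "\<not> snd p < real k" if "k < 2 * n" for k
    using p(2) that of_nat_less_iff[of k "2 * n", where 'a = real] by linarith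
  ultimately show ?thesis unfolding M_def by blast
qed

text \<open>
  Even after moving down by \<open>\<delta>\<close>, the corner \<open>i\<close> is below no other corner and outside the region in which
  coordinates are suppressed, so \<open>M\<close> there is all of \<open>frame i\<close>.
\<close>

lemma frame_in_M:
  assumes i: "i < 6" and x: "x \<in> frame i" and \<delta>: "0 \<le> \<delta>" "\<delta> < real n"
  shows "x \<in> M (corner i + (- \<delta>, - \<delta>))"
proof -
  have xV: "x \<in> carrier V" using x i frame_subspace by (auto simp: V.subspace_iff)
  have "\<not> fst (corner i + (- \<delta>, - \<delta>)) < real k" if "k < 2 * n" for k
  proof -
    have "real k \<le> real (2 * n)" using that by (intro of_nat_mono less_imp_le)
    moreover have "real (4 * n * Suc i) \<ge> real (4 * n)" by (intro of_nat_mono) simp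
    moreover have "fst (corner i + (- \<delta>, - \<delta>)) = real (4 * n * Suc i) - \<delta>" by (simp add: corner_def)
    moreover have "real (4 * n) = real (2 * n) + 2 * real n" by simp
    ultimately show ?thesis using \<delta> by linarith
  qed
  moreover have "j = i" if "corner i + (- \<delta>, - \<delta>) \<le> corner j" for j
  proof -
    have "real (4 * n * Suc i) - \<delta> \<le> real (4 * n * Suc j)" "real (4 * n * Suc j) - \<delta> \<le> real (4 * n * Suc i)"
      using that by (simp_all add: corner_def less_eq_prod_def)
    then have "real (4 * n * Suc i) < real (4 * n * Suc j + n)" "real (4 * n * Suc j) < real (4 * n * Suc i + n)"
      using \<delta> by simp_all
    then have "4 * n * Suc i < 4 * n * Suc j + n" "4 * n * Suc j < 4 * n * Suc i + n"
      by (simp_all only: of_nat_less_iff)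
    then have "n * (4 * Suc i) < n * (4 * Suc j + 1)" "n * (4 * Suc j) < n * (4 * Suc i + 1)"
      by (simp_all add: algebra_simps)
    then show ?thesis by simp
  qed
  ultimately show ?thesis using xV x unfolding M_def by blast
qed

text \<open>
  An idempotent that preserves \<open>T\<close> maps \<open>M (p - (\<delta>, \<delta>))\<close> into \<open>M p\<close>. Taking the corners for \<open>p\<close>, it preserves
  the frame; taking \<open>p = (\<delta>, \<delta>)\<close>, it maps \<open>e\<^sub>0\<close> to a vector without coordinate \<open>d\<close>, as \<open>\<delta> < d\<close>.
\<close>

lemma EN_indecomposable:
  assumes T: "filtration K V T" and low: "\<And>p. M (p + (- \<delta>, - \<delta>)) \<subseteq> T p" and high: "\<And>p. T p \<subseteq> M p"
    and \<delta>: "0 \<le> \<delta>" "\<delta> < real n - 1"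
  shows "T far = carrier V" "indecomposable K (filt V T)"
proof -
  interpret T: filtration K V T by fact
  have "M (far + (- \<delta>, - \<delta>)) = carrier V"
    using \<delta> n2 by (intro M_eventually_V) (simp_all add: far_def)
  then show T_far: "T far = carrier V"
    using low[of far] T.sub[of far] by (auto simp: V.subspace_iff)
  show "indecomposable K (filt V T)"
  proof (rule T.indecomposable_filt[OF T_far])
    have "e 0 0 \<noteq> \<zero>\<^bsub>V\<^esub> 0" by simp
    then show "carrier V \<noteq> {\<zero>\<^bsub>V\<^esub>}" using e_closed[of 0] by (metis singletonD)
  next
    fix \<pi> assume hom: "\<pi> \<in> LinearCombinations.module_hom K V V"
      and idem: "\<And>x. x \<in> carrier V \<Longrightarrow> \<pi> (\<pi> x) = \<pi> x" and T: "\<And>p x. x \<in> T p \<Longrightarrow> \<pi> x \<in> T p"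
    have step: "\<pi> x \<in> M p" if "x \<in> M (p + (- \<delta>, - \<delta>))" for x p
      using T[of x p] low[of p] high[of p] that by blast
    show "(\<forall>x\<in>carrier V. \<pi> x = \<zero>\<^bsub>V\<^esub>) \<or> (\<forall>x\<in>carrier V. \<pi> x = x)"
    proof (rule frame_projection_trivial, unfold_locales)
      show "\<pi> x \<in> frame i" if "i < 6" "x \<in> frame i" for i x
      proof -
        have "\<pi> x \<in> M (corner i)" using step frame_in_M that \<delta> by simp
        then show ?thesis using that unfolding M_def by simp
      qed
      have "\<not> (0, 0) \<le> corner i" for i
      proof -
        have "0 < 4 * n * Suc i" using n2 by simp
        then have "0 < real (4 * n * Suc i)" by (simp only: of_nat_0_less_iff)
        then show ?thesis by (simp add: corner_def less_eq_prod_def del: of_nat_mult of_nat_Suc mult_Suc_right)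
      qed
      then have "e 0 \<in> M ((\<delta>, \<delta>) + (- \<delta>, - \<delta>))" unfolding M_def by simp
      then have "\<pi> (e 0) \<in> M (\<delta>, \<delta>)" by (rule step)
      moreover have "\<delta> < real d" using \<delta> n2 by (simp add: d_def of_nat_diff)
      ultimately show "\<pi> (e 0) d = \<zero>" unfolding M_def by simp
    qed (use hom idem in auto)
  qed
qed

section \<open>The four modules\<close>

text \<open>
  A proper subspace that contains the image of \<open>f\<close>.
\<close>

definition ker0 where "ker0 = {x \<in> carrier V. x 0 = \<zero>}"

lemma ker0_subspace: "VectorSpace.subspace K ker0 V"
  unfolding V.subspace_iff by (auto simp: ker0_def)

lemma ker0_proper: "e 0 \<notin> ker0"
  by (simp add: ker0_def)

lemma im_one_minus_f_proper: "e d \<notin> im_one_minus_f"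
proof
  assume "e d \<in> im_one_minus_f"
  then have "e d = \<zero>\<^bsub>V\<^esub>" by (rule im_one_minus_f_inter_lastline) (auto simp: lastline_def)
  then have "e d d = \<zero>\<^bsub>V\<^esub> d" by simp
  then show False by simp
qed

lemma witnesses:
  "\<exists>(M :: ('k, nat \<Rightarrow> 'k) pmod) (Q :: ('k, nat \<Rightarrow> 'k) pmod)
            (N\<^sub>1 :: ('k, nat \<Rightarrow> 'k) pmod) (N\<^sub>2 :: ('k, nat \<Rightarrow> 'k) pmod).
      pfd K M \<and> pfd K Q \<and> pfd K N\<^sub>1 \<and> pfd K N\<^sub>2 \<and>
      interleaved K 1 (pm_sum M Q) (pm_sum N\<^sub>1 N\<^sub>2) \<and>
      (SUP p. enat (vectorspace.dim K (pm_space M p))) = enat (2 * n) \<and>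
      (SUP p. enat (vectorspace.dim K (pm_space Q p))) \<le> enat (2 * n - 1) \<and>
      (\<forall>\<delta>::real. 0 \<le> \<delta> \<and> \<delta> < real n - 1 \<longrightarrow>
         (\<forall>R\<in>EN K \<delta> M. \<exists>R'\<in>barcode K R.
            \<not> subquotient K R' N\<^sub>1 \<and> \<not> subquotient K R' N\<^sub>2))"
proof -
  interpret Q: filtration K V "\<lambda>p. M (p + (2, 2)) \<inter> ker0 \<inter> im_one_minus_f"
    using M.shift_Int[OF V.subspace_Int[OF ker0_subspace im_one_minus_f_subspace], of 2] by (simp add: Int_assoc)
  interpret N1: filtration K V "\<lambda>p. M (p + (1, 1)) \<inter> ker0"
    using M.shift_Int[OF ker0_subspace, of 1] by simp
  interpret N2: filtration K V "\<lambda>p. M (p + (1, 1)) \<inter> im_one_minus_f"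
    using M.shift_Int[OF im_one_minus_f_subspace, of 1] by simp
  let ?Q = "filt V (\<lambda>p. M (p + (2, 2)) \<inter> ker0 \<inter> im_one_minus_f)"
  let ?N1 = "filt V (\<lambda>p. M (p + (1, 1)) \<inter> ker0)" and ?N2 = "filt V (\<lambda>p. M (p + (1, 1)) \<inter> im_one_minus_f)"
  have proper: "M (p + (2, 2)) \<inter> ker0 \<inter> im_one_minus_f \<noteq> carrier V" "M (p + (1, 1)) \<inter> ker0 \<noteq> carrier V"
    "M (p + (1, 1)) \<inter> im_one_minus_f \<noteq> carrier V" for p
    using ker0_proper im_one_minus_f_proper e_closed by blast+
  have inter: "interleaved K 1 (pm_sum (filt V M) ?Q) (pm_sum ?N1 ?N2)"
    by (rule M.interleaved_filt[OF f_hom f_M ker0_subspace im_one_minus_f_subspace])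
       (auto simp: ker0_def coord_f im_one_minus_f_def)
  have dim_M: "(SUP p. enat (vectorspace.dim K (pm_space (filt V M) p))) = enat (2 * n)"
  proof (rule antisym)
    have "vectorspace.dim K (V\<lparr>carrier := M p\<rparr>) \<le> 2 * n" for p
      using V.proper_subspace_dim_less[OF fin_dim_V M.sub[of p]] dim_V
      by (cases "M p = carrier V") (simp_all del: less_2n)
    then show "(SUP p. enat (vectorspace.dim K (pm_space (filt V M) p))) \<le> enat (2 * n)"
      by (intro SUP_least) (simp add: filt_def)
    have "M far = carrier V" using n2 by (intro M_eventually_V) (simp_all add: far_def)
    then have "vectorspace.dim K (pm_space (filt V M) far) = 2 * n" using dim_V by (simp add: filt_def)
    then show "enat (2 * n) \<le> (SUP p. enat (vectorspace.dim K (pm_space (filt V M) p)))"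
      by (metis SUP_upper UNIV_I)
  qed
  have dim_Q: "(SUP p. enat (vectorspace.dim K (pm_space ?Q p))) \<le> enat (2 * n - 1)"
  proof (rule SUP_least)
    fix p
    have "vectorspace.dim K (V\<lparr>carrier := M (p + (2, 2)) \<inter> ker0 \<inter> im_one_minus_f\<rparr>) < 2 * n"
      using V.proper_subspace_dim_less[OF fin_dim_V Q.sub[of p] proper(1)] dim_V by (simp del: less_2n)
    then show "enat (vectorspace.dim K (pm_space ?Q p)) \<le> enat (2 * n - 1)"
      by (simp add: filt_def del: less_2n)
  qed
  have summand: "\<exists>R'\<in>barcode K R. \<not> subquotient K R' ?N1 \<and> \<not> subquotient K R' ?N2"
    if \<delta>: "0 \<le> \<delta>" "\<delta> < real n - 1" and R: "R \<in> EN K \<delta> (filt V M)" for \<delta> R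
  proof -
    obtain T where T: "filtration K V T" "\<And>p. M (p + (- \<delta>, - \<delta>)) \<subseteq> T p" "\<And>p. T p \<subseteq> M p"
      and iso: "pm_iso K R (filt V T)"
      using M.EN_filt[OF R] by blast
    have ind: "T far = carrier V" "indecomposable K (filt V T)"
      by (rule EN_indecomposable[OF T \<delta>])+
    have "persistence_module K R" using R by (simp add: EN_def)
    then have "R \<in> barcode K R"
      by (intro indecomposable_in_barcode indecomposable_iso[OF iso ind(2)])
    moreover have "\<not> subquotient K R ?N1" "\<not> subquotient K R ?N2"
      by (rule N1.not_subquotient_filt[OF fin_dim_V proper(2) iso ind(1)],
          rule N2.not_subquotient_filt[OF fin_dim_V proper(3) iso ind(1)])
    ultimately show ?thesis by blast
  qed
  show ?thesis
  proof (rule exI[of _ "filt V M"], rule exI[of _ ?Q], rule exI[of _ ?N1], rule exI[of _ ?N2], intro conjI)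
    show "pfd K (filt V M)" "pfd K ?Q" "pfd K ?N1" "pfd K ?N2"
      using fin_dim_V by (rule M.pfd_filt Q.pfd_filt N1.pfd_filt N2.pfd_filt)+
    show "\<forall>\<delta>::real. 0 \<le> \<delta> \<and> \<delta> < real n - 1 \<longrightarrow>
        (\<forall>R\<in>EN K \<delta> (filt V M). \<exists>R'\<in>barcode K R. \<not> subquotient K R' ?N1 \<and> \<not> subquotient K R' ?N2)"
      using summand by blast
  qed (fact inter dim_M dim_Q)+
qed

end

theorem theorem5p9:
  fixes K :: "('k, 'm) ring_scheme" and n :: nat
  assumes "field K" and "n \<ge> 2"
  shows "\<exists>(M :: ('k, nat \<Rightarrow> 'k) pmod) (Q :: ('k, nat \<Rightarrow> 'k) pmod)
            (N\<^sub>1 :: ('k, nat \<Rightarrow> 'k) pmod) (N\<^sub>2 :: ('k, nat \<Rightarrow> 'k) pmod).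
      pfd K M \<and> pfd K Q \<and> pfd K N\<^sub>1 \<and> pfd K N\<^sub>2 \<and>
      interleaved K 1 (pm_sum M Q) (pm_sum N\<^sub>1 N\<^sub>2) \<and>
      (SUP p. enat (vectorspace.dim K (pm_space M p))) = enat (2 * n) \<and>
      (SUP p. enat (vectorspace.dim K (pm_space Q p))) \<le> enat (2 * n - 1) \<and>
      (\<forall>\<delta>::real. 0 \<le> \<delta> \<and> \<delta> < real n - 1 \<longrightarrow>
         (\<forall>R\<in>EN K \<delta> M. \<exists>R'\<in>barcode K R.
            \<not> subquotient K R' N\<^sub>1 \<and> \<not> subquotient K R' N\<^sub>2))"
proof -
  interpret chain_space K n
    using assms by (simp add: chain_space_def chain_space_axioms_def coord_space_def)
  show ?thesis by (rule witnesses)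
qed

end
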